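(* Let a universal constant $C>0$, an initial point $x_0\in\mathrm{dom}\,h$, and a tolerance $\bar\varepsilon>0$ be given, and consider an instance $(f,f';h)$ of $\min\{\phi(x)=f(x)+h(x):x\in\mathbb{R}^n\}$ satisfying (A1)-(A3). Then any variant of the $\tau$-free GPB subclass with input $(x_0,\lambda,\bar\varepsilon)$ satisfying $$\frac{\bar\varepsilon}{CT_{\bar\varepsilon}^2}\le\lambda\le\frac{Cd_0^2}{\bar\varepsilon}$$ obtains a $\bar\varepsilon$-solution of the instance $(f,f';h)$ of $\min\{\phi(x)=f(x)+h(x):x\in\mathbb{R}^n\}$ in a number of iterations bounded, up to a logarithmic term, by $$\mathcal{O}\left(\min\left\{\frac{T_{\bar\varepsilon}^2d_0^2}{\bar\varepsilon^2},\left(\frac{T_{\bar\varepsilon}^2}{\mu\bar\varepsilon}+1\right)\log\left(\frac{\mu d_0^2}{\bar\varepsilon}+1\right)\right\}+1\right).$$ That is, there is a constant $C'>0$ depending only on $C$ such that the number of iterations is at most $C'(1+\log_+(4\bar t/\bar\varepsilon))$ times the expression inside $\mathcal{O}(\cdot)$.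
   Context: Notation. $\|\cdot\|$ and $\langle\cdot,\cdot\rangle$ are the Euclidean norm and inner product on $\mathbb{R}^n$; $\log$ is the natural logarithm; $\log_+(s)=\max\{0,\log s\}$ for $s>0$ and $\log_+(0)=0$. For $\mu\ge0$, $\overline{\mathrm{Conv}}_\mu(\mathbb{R}^n)$ is the set of proper lower semicontinuous functions $\Psi:\mathbb{R}^n\to(-\infty,+\infty]$ such that $\Psi-\mu\|\cdot\|^2/2$ is convex; $\overline{\mathrm{Conv}}(\mathbb{R}^n)$ is the case $\mu=0$. Problem. $\phi_*=\min\{\phi(x):=f(x)+h(x):x\in\mathbb{R}^n\}$. A $\bar\varepsilon$-solution is a point $\bar x\in\mathrm{dom}\,h$ with $\phi(\bar x)-\phi_*\le\bar\varepsilon$. The assumptions for a triple $(L_f,M_f,\mu)\in\mathbb{R}_+^3$ are: (A1) $f\in\overline{\mathrm{Conv}}(\mathbb{R}^n)$, $h\in\overline{\mathrm{Conv}}_\mu(\mathbb{R}^n)$, $\mathrm{dom}\,h\subset\mathrm{dom}\,f$, and $f':\mathrm{dom}\,h\to\mathbb{R}^n$ is a given function with $f'(x)\in\partial f(x)$ for all $x\in\mathrm{dom}\,h$; (A2) the set $X^*$ of optimal solutions is nonempty; (A3) $\|f'(x)-f'(y)\|\le2M_f+L_f\|x-y\|$ for all $x,y\in\mathrm{dom}\,h$. Let $\ell_f(u;x)=f(x)+\langle f'(x),u-x\rangle$, $x_0^*=\mathrm{argmin}\{\|x_0-x^*\|:x^*\in X^*\}$ and $d_0=\|x_0-x_0^*\|$.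 Let $\Omega\subset\mathbb{R}_+^2$ be the set of all pairs $(M,L)$ for which (A3) holds with $(M_f,L_f)=(M,L)$; $(\bar M_f,\bar L_f)$ is the unique minimizer of $M^2+\bar\varepsilon L$ over $\Omega$, and $T_{\bar\varepsilon}=(\bar M_f^2+\bar\varepsilon\bar L_f)^{1/2}$. Also $$\bar t:=\bar M_f^2+4(\bar L_f+2)\bigl(\max\{1,2\lambda\bar L_f\}d_0+\lambda\bar M_f\bigr)^2.$$ When $\mu=0$, the second term of the minimum in the bound is by convention equal to the first. GPB framework. The input is $x_0\in\mathrm{dom}\,h$, $\lambda>0$, $\bar\varepsilon>0$, $\tau\in(0,1)$ with $\frac{\tau}{1-\tau}\ge\frac{8\lambda T_{\bar\varepsilon}^2}{(1+\lambda\mu)\bar\varepsilon}$. Set $y_0=x_0$, $t_0=0$. For $j=1,2,\dots$: Step 1. If $t_{j-1}\le\bar\varepsilon/2$ (serious update), set $x_j^c=x_{j-1}$ and choose any $\Gamma_j\in\overline{\mathrm{Conv}}_\mu(\mathbb{R}^n)$ with $\ell_f(\cdot;x_{j-1})+h\le\Gamma_j\le\phi$. Otherwise (null update), set $x_j^c=x_{j-1}^c$ and choose any $\Gamma_j\in\overline{\mathrm{Conv}}_\mu(\mathbb{R}^n)$ such that $\tau\bar\Gamma+(1-\tau)[\ell_f(\cdot;x_{j-1})+h]\le\Gamma_j\le\phi$ for some $\bar\Gamma\in\overline{\mathrm{Conv}}_\mu(\mathbb{R}^n)$ with $\bar\Gamma(x_{j-1})=\Gamma_{j-1}(x_{j-1})$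 and $x_{j-1}=\mathrm{argmin}_u\{\bar\Gamma(u)+\frac1{2\lambda}\|u-x_{j-1}^c\|^2\}$. Step 2. Compute $x_j=\mathrm{argmin}_u\{\Gamma_j(u)+\frac1{2\lambda}\|u-x_j^c\|^2\}$, choose $y_j\in\mathrm{Argmin}\{\phi(x):x\in\{x_0,\dots,x_j\}\}$, and set $m_j=\Gamma_j(x_j)+\frac1{2\lambda}\|x_j-x_j^c\|^2$, $t_j=\phi(y_j)-m_j$. The number of iterations to obtain a $\bar\varepsilon$-solution is the first $j$ for which $y_j$ is a $\bar\varepsilon$-solution. $\tau$-free GPB subclass: the GPB methods that do not depend on $\tau$ (do not take it as input), i.e. their input is $(x_0,\lambda,\bar\varepsilon)$ and the sequences they generate satisfy the initialization $y_0=x_0$, $t_0=0$ and the requirements of Steps 1 and 2 of the GPB framework for every admissible $\tau$, i.e. for every $\tau\in(0,1)$ with $\frac{\tau}{1-\tau}\ge\frac{8\lambda T_{\bar\varepsilon}^2}{(1+\lambda\mu)\bar\varepsilon}$. *)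

theory Defs
  imports "HOL-Analysis.Analysis"
begin

section \<open>Euclidean spaces of every dimension inside one type\<close>

text \<open>
  The constant of the complexity bound must not depend on the dimension \<open>n\<close>, so \<open>n\<close> has to be
  quantified inside the statement, after that constant. This rules out encoding \<open>n\<close> as a type
  (a finite index type or a type of class \<^class>\<open>euclidean_space\<close>). Instead, all spaces
  \<open>\<real>\<^sup>n\<close> live inside the inner product space of finitely supported real
  sequences, as the subspaces \<open>Rn n\<close> of sequences vanishing from index \<open>n\<close> on.
\<close>

typedef fseq = "{x :: nat \<Rightarrow> real. finite {i. x i \<noteq> 0}}"
  morphisms coord Abs_fseq
  by (rule exI[of _ "\<lambda>_. 0"]) simp

setup_lifting type_definition_fseq

lemma finite_coord [simp]: "finite {i. coord x i \<noteq> 0}"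
  using coord[of x] by simp

lemma fseq_eq_iff: "x = y \<longleftrightarrow> (\<forall>i. coord x i = coord y i)"
  by (metis coord_inject ext)

instantiation fseq :: real_vector
begin

lift_definition zero_fseq :: fseq is "\<lambda>_. 0" by simp

lift_definition plus_fseq :: "fseq \<Rightarrow> fseq \<Rightarrow> fseq" is "\<lambda>x y i. x i + y i"
proof -
  fix x y :: "nat \<Rightarrow> real"
  assume "finite {i. x i \<noteq> 0}" "finite {i. y i \<noteq> 0}"
  then have "finite ({i. x i \<noteq> 0} \<union> {i. y i \<noteq> 0})" by simp
  then show "finite {i. x i + y i \<noteq> 0}" by (rule rev_finite_subset) auto
qed

lift_definition minus_fseq :: "fseq \<Rightarrow> fseq \<Rightarrow> fseq" is "\<lambda>x y i. x i - y i"
proof -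
  fix x y :: "nat \<Rightarrow> real"
  assume "finite {i. x i \<noteq> 0}" "finite {i. y i \<noteq> 0}"
  then have "finite ({i. x i \<noteq> 0} \<union> {i. y i \<noteq> 0})" by simp
  then show "finite {i. x i - y i \<noteq> 0}" by (rule rev_finite_subset) auto
qed

lift_definition uminus_fseq :: "fseq \<Rightarrow> fseq" is "\<lambda>x i. - x i" by simp

lift_definition scaleR_fseq :: "real \<Rightarrow> fseq \<Rightarrow> fseq" is "\<lambda>r x i. r * x i"
  by (erule rev_finite_subset) auto

instance
  by standard (transfer, auto simp: algebra_simps)+

end

lemma coord_simps [simp]:
  "coord 0 i = 0"
  "coord (x + y) i = coord x i + coord y i"
  "coord (x - y) i = coord x i - coord y i"
  "coord (- x) i = - coord x i"
  "coord (r *\<^sub>R x) i = r * coord x i"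
  by (transfer, simp)+

instantiation fseq :: real_inner
begin

definition inner_fseq :: "fseq \<Rightarrow> fseq \<Rightarrow> real" where
  "inner_fseq x y = (\<Sum>i | coord x i \<noteq> 0. coord x i * coord y i)"

definition norm_fseq :: "fseq \<Rightarrow> real" where
  "norm_fseq x = sqrt (inner x x)"

definition sgn_fseq :: "fseq \<Rightarrow> fseq" where
  "sgn_fseq x = x /\<^sub>R norm x"

definition dist_fseq :: "fseq \<Rightarrow> fseq \<Rightarrow> real" where
  "dist_fseq x y = norm (x - y)"

definition uniformity_fseq :: "(fseq \<times> fseq) filter" where
  "uniformity_fseq = (INF e\<in>{0 <..}. principal {(x, y). dist x y < e})"

definition open_fseq :: "fseq set \<Rightarrow> bool" where
  "open_fseq U \<longleftrightarrow> (\<forall>x\<in>U. eventually (\<lambda>(x', y). x' = x \<longrightarrow> y \<in> U) uniformity)"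

lemma inner_fseq_superset:
  assumes "finite A" "{i. coord x i \<noteq> 0} \<subseteq> A"
  shows "inner x y = (\<Sum>i\<in>A. coord x i * coord y i)"
  unfolding inner_fseq_def using assms by (intro sum.mono_neutral_left) auto

instance
proof
  fix x y z :: fseq and r :: real
  let ?A = "{i. coord x i \<noteq> 0} \<union> {i. coord y i \<noteq> 0}"
  have A: "finite ?A" by simp
  have ix: "inner x w = (\<Sum>i\<in>?A. coord x i * coord w i)" for w
    using A by (rule inner_fseq_superset) auto
  have iy: "inner y w = (\<Sum>i\<in>?A. coord y i * coord w i)" for w
    using A by (rule inner_fseq_superset) auto
  have ixy: "inner (x + y) w = (\<Sum>i\<in>?A. coord (x + y) i * coord w i)" for w
    using A by (rule inner_fseq_superset) auto
  have irx: "inner (r *\<^sub>R x) w = (\<Sum>i\<in>?A. coord (r *\<^sub>R x) i * coord w i)" for w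
    using A by (rule inner_fseq_superset) auto
  show "inner x y = inner y x"
    by (simp add: ix iy mult.commute)
  show "inner (x + y) z = inner x z + inner y z"
    by (simp only: ix iy ixy) (simp add: distrib_right sum.distrib)
  show "inner (r *\<^sub>R x) y = r * inner x y"
    by (simp only: ix irx) (simp add: sum_distrib_left mult.assoc)
  show "0 \<le> inner x x"
    by (simp add: inner_fseq_def sum_nonneg)
  show "inner x x = 0 \<longleftrightarrow> x = 0"
    by (auto simp: inner_fseq_def sum_nonneg_eq_0_iff fseq_eq_iff)
  show "norm x = sqrt (inner x x)"
    by (fact norm_fseq_def)
  show "sgn x = x /\<^sub>R norm x"
    by (fact sgn_fseq_def)
  show "dist x y = norm (x - y)"
    by (fact dist_fseq_def)
  show "uniformity = (INF e\<in>{0 <..}. principal {(x, y). dist (x::fseq) y < e})"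
    by (fact uniformity_fseq_def)
  show "open U \<longleftrightarrow> (\<forall>x\<in>U. \<forall>\<^sub>F (x', y) in uniformity. x' = x \<longrightarrow> y \<in> U)" for U :: "fseq set"
    by (fact open_fseq_def)
qed

end

definition Rn :: "nat \<Rightarrow> fseq set" where
  "Rn n = {x. \<forall>i\<ge>n. coord x i = 0}"

text \<open>The next two facts identify \<open>Rn n\<close>, with its inherited inner product, with
  Euclidean \<open>n\<close>-space.\<close>

lemma inner_Rn:
  assumes "x \<in> Rn n"
  shows "inner x y = (\<Sum>i<n. coord x i * coord y i)"
  using assms by (intro inner_fseq_superset) (auto simp: Rn_def not_less[symmetric])

lemma ex1_Rn: "\<exists>!x. x \<in> Rn n \<and> (\<forall>i<n. coord x i = a i)"
proof -
  define x where "x = Abs_fseq (\<lambda>i. if i < n then a i else 0)"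
  have "finite {i. (if i < n then a i else 0) \<noteq> 0}"
    by (rule finite_subset[of _ "{..<n}"]) auto
  then have x: "coord x i = (if i < n then a i else 0)" for i
    unfolding x_def by (subst Abs_fseq_inverse) auto
  show ?thesis
  proof (rule ex1I[of _ x])
    show "x \<in> Rn n \<and> (\<forall>i<n. coord x i = a i)"
      by (simp add: Rn_def x)
    show "y = x" if "y \<in> Rn n \<and> (\<forall>i<n. coord y i = a i)" for y
      using that by (auto simp: Rn_def fseq_eq_iff x not_less)
  qed
qed

lemma subspace_Rn: "subspace (Rn n)"
  by (auto simp: subspace_def Rn_def)


section \<open>Convex analysis for extended-real-valued functions\<close>

text \<open>
  Throughout, \<open>V\<close> is the ambient space (\<open>Rn n\<close> in the theorem). Functions on \<open>V\<close> are total functions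
  of the surrounding type whose values outside \<open>V\<close> are irrelevant.
\<close>

definition edom :: "'a set \<Rightarrow> ('a \<Rightarrow> ereal) \<Rightarrow> 'a set" where
  "edom V \<Psi> = {x \<in> V. \<Psi> x < \<infinity>}"

definition proper_on :: "'a set \<Rightarrow> ('a \<Rightarrow> ereal) \<Rightarrow> bool" where
  "proper_on V \<Psi> \<longleftrightarrow> (\<forall>x\<in>V. \<Psi> x \<noteq> -\<infinity>) \<and> edom V \<Psi> \<noteq> {}"

definition lsc_on :: "'a::topological_space set \<Rightarrow> ('a \<Rightarrow> ereal) \<Rightarrow> bool" where
  "lsc_on V \<Psi> \<longleftrightarrow> (\<forall>x\<in>V. \<Psi> x \<le> Liminf (at x within V) \<Psi>)"

definition econvex_on :: "'a::real_vector set \<Rightarrow> ('a \<Rightarrow> ereal) \<Rightarrow> bool" where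
  "econvex_on V \<Psi> \<longleftrightarrow> convex {(x, r::real). x \<in> V \<and> \<Psi> x \<le> ereal r}"

definition Conv :: "'a::real_inner set \<Rightarrow> real \<Rightarrow> ('a \<Rightarrow> ereal) set" where
  "Conv V \<mu> = {\<Psi>. proper_on V \<Psi> \<and> lsc_on V \<Psi> \<and>
     econvex_on V (\<lambda>x. \<Psi> x - ereal (\<mu> * (norm x)\<^sup>2 / 2))}"

definition subdifferential :: "'a::real_inner set \<Rightarrow> ('a \<Rightarrow> ereal) \<Rightarrow> 'a \<Rightarrow> 'a set" where
  "subdifferential V \<Psi> x = {g \<in> V. \<forall>u\<in>V. \<Psi> x + ereal (inner g (u - x)) \<le> \<Psi> u}"

abbreviation is_argmin_on :: "'a set \<Rightarrow> ('a \<Rightarrow> 'b::ord) \<Rightarrow> 'a \<Rightarrow> bool" where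
  "is_argmin_on S F \<equiv> is_arg_min F (\<lambda>x. x \<in> S)"


section \<open>The composite problem\<close>

definition phi :: "('a \<Rightarrow> ereal) \<Rightarrow> ('a \<Rightarrow> ereal) \<Rightarrow> 'a \<Rightarrow> ereal" where
  "phi f h x = f x + h x"

definition phi_opt :: "'a set \<Rightarrow> ('a \<Rightarrow> ereal) \<Rightarrow> ('a \<Rightarrow> ereal) \<Rightarrow> ereal" where
  "phi_opt V f h = (INF x\<in>V. phi f h x)"

definition opt_set :: "'a set \<Rightarrow> ('a \<Rightarrow> ereal) \<Rightarrow> ('a \<Rightarrow> ereal) \<Rightarrow> 'a set" where
  "opt_set V f h = {x. is_argmin_on V (phi f h) x}"

definition eps_solution ::
  "'a set \<Rightarrow> ('a \<Rightarrow> ereal) \<Rightarrow> ('a \<Rightarrow> ereal) \<Rightarrow> real \<Rightarrow> 'a \<Rightarrow> bool" where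
  "eps_solution V f h \<epsilon> x \<longleftrightarrow> x \<in> edom V h \<and> phi f h x - phi_opt V f h \<le> ereal \<epsilon>"

definition A3 ::
  "'a::real_inner set \<Rightarrow> ('a \<Rightarrow> 'a) \<Rightarrow> ('a \<Rightarrow> ereal) \<Rightarrow> real \<Rightarrow> real \<Rightarrow> bool" where
  "A3 V f' h M L \<longleftrightarrow>
     (\<forall>x\<in>edom V h. \<forall>y\<in>edom V h. norm (f' x - f' y) \<le> 2 * M + L * norm (x - y))"

definition instance_A1_A3 ::
  "'a::real_inner set \<Rightarrow> ('a \<Rightarrow> ereal) \<Rightarrow> ('a \<Rightarrow> 'a) \<Rightarrow> ('a \<Rightarrow> ereal) \<Rightarrow>
     real \<Rightarrow> real \<Rightarrow> real \<Rightarrow> bool" where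
  "instance_A1_A3 V f f' h Lf Mf \<mu> \<longleftrightarrow>
     0 \<le> Lf \<and> 0 \<le> Mf \<and> 0 \<le> \<mu> \<and>
     f \<in> Conv V 0 \<and> h \<in> Conv V \<mu> \<and> edom V h \<subseteq> edom V f \<and>
     (\<forall>x\<in>edom V h. f' x \<in> subdifferential V f x) \<and>
     opt_set V f h \<noteq> {} \<and>
     A3 V f' h Mf Lf"

definition lin :: "('a::real_inner \<Rightarrow> ereal) \<Rightarrow> ('a \<Rightarrow> 'a) \<Rightarrow> 'a \<Rightarrow> 'a \<Rightarrow> ereal" where
  "lin f f' u x = f x + ereal (inner (f' x) (u - x))"

text \<open>The set of admissible pairs, in the order \<open>(M, L)\<close>.\<close>

definition Omega ::
  "'a::real_inner set \<Rightarrow> ('a \<Rightarrow> 'a) \<Rightarrow> ('a \<Rightarrow> ereal) \<Rightarrow> (real \<times> real) set" where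
  "Omega V f' h = {(M, L). 0 \<le> M \<and> 0 \<le> L \<and> A3 V f' h M L}"

definition T_eps :: "real \<Rightarrow> real \<Rightarrow> real \<Rightarrow> real" where
  "T_eps \<epsilon> M L = sqrt (M\<^sup>2 + \<epsilon> * L)"

definition tbar :: "real \<Rightarrow> real \<Rightarrow> real \<Rightarrow> real \<Rightarrow> real" where
  "tbar lam d0 M L = M\<^sup>2 + 4 * (L + 2) * (max 1 (2 * lam * L) * d0 + lam * M)\<^sup>2"

definition log_plus :: "real \<Rightarrow> real" where
  "log_plus s = (if s = 0 then 0 else max 0 (ln s))"


section \<open>The generic proximal bundle framework\<close>

definition prox_obj ::
  "('a::real_inner \<Rightarrow> ereal) \<Rightarrow> real \<Rightarrow> 'a \<Rightarrow> 'a \<Rightarrow> ereal" where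
  "prox_obj \<Gamma> lam c u = \<Gamma> u + ereal ((norm (u - c))\<^sup>2 / (2 * lam))"

text \<open>
  Conditions on the sequences produced by the framework with input \<open>(x0, lam, \<epsilon>, \<tau>)\<close>. The argument
  \<open>xc\<close> is the sequence of prox-centers. The values of \<open>xc\<close>, \<open>\<Gamma>\<close> and \<open>m\<close> at index \<open>0\<close> play no role:
  since \<open>t 0 = 0\<close>, the first iteration is a serious update.
\<close>

definition GPB ::
  "'a::real_inner set \<Rightarrow> ('a \<Rightarrow> ereal) \<Rightarrow> ('a \<Rightarrow> 'a) \<Rightarrow> ('a \<Rightarrow> ereal) \<Rightarrow> real \<Rightarrow>
   'a \<Rightarrow> real \<Rightarrow> real \<Rightarrow> real \<Rightarrow>
   (nat \<Rightarrow> 'a) \<Rightarrow> (nat \<Rightarrow> 'a) \<Rightarrow> (nat \<Rightarrow> 'a) \<Rightarrow>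
   (nat \<Rightarrow> 'a \<Rightarrow> ereal) \<Rightarrow> (nat \<Rightarrow> ereal) \<Rightarrow> (nat \<Rightarrow> ereal) \<Rightarrow> bool" where
  "GPB V f f' h \<mu> x0 lam \<epsilon> \<tau> x xc y \<Gamma> m t \<longleftrightarrow>
     x 0 = x0 \<and> y 0 = x0 \<and> t 0 = 0 \<and>
     (\<forall>j\<ge>1.
        (if t (j - 1) \<le> ereal (\<epsilon> / 2) then
           xc j = x (j - 1) \<and>
           \<Gamma> j \<in> Conv V \<mu> \<and>
           (\<forall>u\<in>V. lin f f' u (x (j - 1)) + h u \<le> \<Gamma> j u \<and> \<Gamma> j u \<le> phi f h u)
         else
           xc j = xc (j - 1) \<and>
           \<Gamma> j \<in> Conv V \<mu> \<and>
           (\<exists>\<Gamma>b\<in>Conv V \<mu>.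
              \<Gamma>b (x (j - 1)) = \<Gamma> (j - 1) (x (j - 1)) \<and>
              is_argmin_on V (prox_obj \<Gamma>b lam (xc (j - 1))) (x (j - 1)) \<and>
              (\<forall>u\<in>V.
                 ereal \<tau> * \<Gamma>b u + ereal (1 - \<tau>) * (lin f f' u (x (j - 1)) + h u) \<le> \<Gamma> j u \<and>
                 \<Gamma> j u \<le> phi f h u))) \<and>
        is_argmin_on V (prox_obj (\<Gamma> j) lam (xc j)) (x j) \<and>
        is_argmin_on (x ` {0..j}) (phi f h) (y j) \<and>
        m j = prox_obj (\<Gamma> j) lam (xc j) (x j) \<and>
        t j = phi f h (y j) - m j)"

definition admissible_tau :: "real \<Rightarrow> real \<Rightarrow> real \<Rightarrow> real \<Rightarrow> real \<Rightarrow> bool" where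
  "admissible_tau \<mu> lam \<epsilon> T \<tau> \<longleftrightarrow>
     0 < \<tau> \<and> \<tau> < 1 \<and> 8 * lam * T\<^sup>2 / ((1 + lam * \<mu>) * \<epsilon>) \<le> \<tau> / (1 - \<tau>)"

text \<open>In a null update the auxiliary function \<open>\<Gamma>b\<close> may depend on \<open>\<tau>\<close>;
  the generated sequences may not.\<close>

definition tau_free_GPB ::
  "'a::real_inner set \<Rightarrow> ('a \<Rightarrow> ereal) \<Rightarrow> ('a \<Rightarrow> 'a) \<Rightarrow> ('a \<Rightarrow> ereal) \<Rightarrow> real \<Rightarrow> real \<Rightarrow>
   'a \<Rightarrow> real \<Rightarrow> real \<Rightarrow>
   (nat \<Rightarrow> 'a) \<Rightarrow> (nat \<Rightarrow> 'a) \<Rightarrow> (nat \<Rightarrow> 'a) \<Rightarrow>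
   (nat \<Rightarrow> 'a \<Rightarrow> ereal) \<Rightarrow> (nat \<Rightarrow> ereal) \<Rightarrow> (nat \<Rightarrow> ereal) \<Rightarrow> bool" where
  "tau_free_GPB V f f' h \<mu> T x0 lam \<epsilon> x xc y \<Gamma> m t \<longleftrightarrow>
     (\<forall>\<tau>. admissible_tau \<mu> lam \<epsilon> T \<tau> \<longrightarrow> GPB V f f' h \<mu> x0 lam \<epsilon> \<tau> x xc y \<Gamma> m t)"

text \<open>The expression inside the big-O; for \<open>\<mu> = 0\<close> the second term of the minimum equals the first
  by convention.\<close>

definition complexity :: "real \<Rightarrow> real \<Rightarrow> real \<Rightarrow> real \<Rightarrow> real" where
  "complexity \<mu> \<epsilon> T d0 =
     (let a = T\<^sup>2 * d0\<^sup>2 / \<epsilon>\<^sup>2;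
          b = (if \<mu> = 0 then a else (T\<^sup>2 / (\<mu> * \<epsilon>) + 1) * ln (\<mu> * d0\<^sup>2 / \<epsilon> + 1))
      in min a b + 1)"

end

theory Submission
  imports Defs
begin

text \<open>
  Cut a run into cycles: a cycle begins with a serious update and continues with null updates
  until the gap \<open>t\<close> is at most \<open>\<epsilon> / 2\<close> again. The bound is a bound on the length of a cycle times a
  bound on the number of cycles completed before a \<open>\<epsilon>\<close>-solution shows up.

  \<^emph>\<open>Length.\<close> Replacing \<open>f\<close> by its linearization lowers the objective by at most \<open>2 M r + L r\<^sup>2\<close> at
  distance \<open>r\<close> from the linearization point (\<open>lin_lower\<close>). In a null update this loss, weighted by
  \<open>1 - \<tau>\<close>, is paid for up to \<open>\<epsilon> / 4\<close> by \<open>\<tau>\<close> times the strong convexity of the prox objective;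
  this is what the lower bound on \<open>\<tau> / (1 - \<tau>)\<close> provides. So the gap contracts towards \<open>\<epsilon> / 4\<close>
  with factor \<open>\<tau>\<close> (\<open>null_gap\<close>). It starts at most at a constant multiple of \<open>tbar\<close>, because the
  first step of a cycle is not long (\<open>serious_step_length\<close>, \<open>serious_gap\<close>). A cycle therefore
  takes about \<open>log_plus (4 * tbar / \<epsilon>) / (1 - \<tau>)\<close> iterations. Since the generated sequences obey the
  rules for every admissible \<open>\<tau>\<close>, the smallest one can be used, for which
  \<open>1 / (1 - \<tau>) = 1 + 8 lam T\<^sup>2 / ((1 + lam \<mu>) \<epsilon>)\<close>.

  \<^emph>\<open>Number.\<close> A cycle acts like one inexact proximal step: comparing its last prox objective at
  the solution \<open>xs\<close> with its minimum gives
  \<open>(1 + lam \<mu>) |xs - x|\<^sup>2 + \<epsilon> lam \<le> |xs - xc|\<^sup>2\<close> (\<open>descent\<close>), where \<open>xc\<close> is the center of the cycle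
  and \<open>x\<close> the center of the next one. Iterated over \<open>k\<close> cycles, this yields
  \<open>\<epsilon> lam \<Sum>i<k. (1 + lam \<mu>) ^ i \<le> d0\<^sup>2\<close>, which limits \<open>k\<close> by \<open>d0\<^sup>2 / (\<epsilon> lam)\<close> and, for \<open>\<mu> > 0\<close>, by
  \<open>ln (1 + \<mu> d0\<^sup>2 / \<epsilon>) / ln (1 + lam \<mu>)\<close>.

  The product of the two bounds is at most a multiple of the complexity expression once
  \<open>lam\<close> lies between \<open>\<epsilon> / (C T\<^sup>2)\<close> and \<open>C d0\<^sup>2 / \<epsilon>\<close> (\<open>cycles_le_complexity\<close>).
\<close>

section \<open>Strong convexity\<close>

lemma norm_convex_combination_sq:
  fixes x u c :: "'a::real_inner"
  shows "(norm ((1 - s) *\<^sub>R x + s *\<^sub>R u - c))\<^sup>2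
    = (1 - s) * (norm (x - c))\<^sup>2 + s * (norm (u - c))\<^sup>2 - s * (1 - s) * (norm (u - x))\<^sup>2"
  unfolding power2_norm_eq_inner
  by (simp add: inner_diff_left inner_diff_right inner_add_left inner_add_right inner_commute
      algebra_simps)

text \<open>Convexity of \<open>\<Psi> - \<mu> |\<cdot>|\<^sup>2 / 2\<close> is used through real upper bounds \<open>a\<close>, \<open>b\<close> of the values, that is,
  through points of the epigraph, so that infinite values need no separate treatment.\<close>

lemma Conv_combination:
  fixes \<Psi> :: "'a::real_inner \<Rightarrow> ereal"
  assumes \<Psi>: "\<Psi> \<in> Conv V \<mu>" and x: "x \<in> V" "\<Psi> x \<le> ereal a" and u: "u \<in> V" "\<Psi> u \<le> ereal b"
    and s: "0 \<le> s" "s \<le> 1"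
  shows "(1 - s) *\<^sub>R x + s *\<^sub>R u \<in> V"
    and "\<Psi> ((1 - s) *\<^sub>R x + s *\<^sub>R u)
      \<le> ereal ((1 - s) * a + s * b - \<mu> / 2 * (s * (1 - s) * (norm (u - x))\<^sup>2))"
proof -
  let ?E = "{(x, r::real). x \<in> V \<and> \<Psi> x - ereal (\<mu> * (norm x)\<^sup>2 / 2) \<le> ereal r}"
  let ?z = "(1 - s) *\<^sub>R x + s *\<^sub>R u"
  have E: "convex ?E" using \<Psi> unfolding Conv_def econvex_on_def by simp
  have px: "(x, a - \<mu> * (norm x)\<^sup>2 / 2) \<in> ?E" using x by (cases "\<Psi> x") auto
  have pu: "(u, b - \<mu> * (norm u)\<^sup>2 / 2) \<in> ?E" using u by (cases "\<Psi> u") auto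
  have "(1 - s) *\<^sub>R (x, a - \<mu> * (norm x)\<^sup>2 / 2) + s *\<^sub>R (u, b - \<mu> * (norm u)\<^sup>2 / 2) \<in> ?E"
    using E px pu s by (intro convexD) auto
  then have z: "?z \<in> V"
    and le: "\<Psi> ?z - ereal (\<mu> * (norm ?z)\<^sup>2 / 2)
      \<le> ereal ((1 - s) * (a - \<mu> * (norm x)\<^sup>2 / 2) + s * (b - \<mu> * (norm u)\<^sup>2 / 2))"
    by auto
  show "?z \<in> V" by (fact z)
  have "(norm ?z)\<^sup>2 = (1 - s) * (norm x)\<^sup>2 + s * (norm u)\<^sup>2 - s * (1 - s) * (norm (u - x))\<^sup>2"
    using norm_convex_combination_sq[of s x u 0] by simp
  then have eq: "(1 - s) * (a - \<mu> * (norm x)\<^sup>2 / 2) + s * (b - \<mu> * (norm u)\<^sup>2 / 2) + \<mu> * (norm ?z)\<^sup>2 / 2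
    = (1 - s) * a + s * b - \<mu> / 2 * (s * (1 - s) * (norm (u - x))\<^sup>2)"
    by (simp only:) (simp add: field_simps)
  have "\<Psi> ?z \<le> ereal ((1 - s) * (a - \<mu> * (norm x)\<^sup>2 / 2) + s * (b - \<mu> * (norm u)\<^sup>2 / 2)
      + \<mu> * (norm ?z)\<^sup>2 / 2)"
    using le by (cases "\<Psi> ?z") auto
  then show "\<Psi> ?z \<le> ereal ((1 - s) * a + s * b - \<mu> / 2 * (s * (1 - s) * (norm (u - x))\<^sup>2))"
    by (simp only: eq)
qed

lemma prox_argmin_finite:
  fixes \<Psi> :: "'a::real_inner \<Rightarrow> ereal"
  assumes \<Psi>: "\<Psi> \<in> Conv V \<mu>" and x: "is_argmin_on V (prox_obj \<Psi> lam c) x"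
  shows "x \<in> V" and "\<bar>\<Psi> x\<bar> \<noteq> \<infinity>"
proof -
  show xV: "x \<in> V" using x by (simp add: is_arg_min_def)
  obtain u where u: "u \<in> V" "\<Psi> u < \<infinity>"
    using \<Psi> unfolding Conv_def proper_on_def edom_def by auto
  then have "prox_obj \<Psi> lam c u < \<infinity>" by (simp add: prox_obj_def)
  moreover have "\<not> prox_obj \<Psi> lam c u < prox_obj \<Psi> lam c x"
    using x u by (auto simp: is_arg_min_def)
  ultimately have "\<Psi> x \<noteq> \<infinity>" by (auto simp: prox_obj_def)
  moreover have "\<Psi> x \<noteq> -\<infinity>" using \<Psi> xV unfolding Conv_def proper_on_def by auto
  ultimately show "\<bar>\<Psi> x\<bar> \<noteq> \<infinity>" by auto
qed

text \<open>Growth of the prox objective around its minimizer: it is strongly convex with modulus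
  \<open>\<mu> + 1 / lam\<close>. Minimality of \<open>x\<close> is compared with the points at fraction \<open>s\<close> of the way to \<open>u\<close>;
  after division by \<open>s\<close>, the limit \<open>s \<rightarrow> 0\<close> gives the full modulus.\<close>

lemma prox_three_point:
  fixes \<Psi> :: "'a::real_inner \<Rightarrow> ereal"
  assumes \<Psi>: "\<Psi> \<in> Conv V \<mu>" and lam: "0 < lam"
    and x: "is_argmin_on V (prox_obj \<Psi> lam c) x" and gx: "\<Psi> x = ereal g"
    and u: "u \<in> V" "\<Psi> u \<le> ereal a"
  shows "g + (norm (x - c))\<^sup>2 / (2 * lam) + (1 + lam * \<mu>) / (2 * lam) * (norm (u - x))\<^sup>2
    \<le> a + (norm (u - c))\<^sup>2 / (2 * lam)"
proof -
  define X where "X = g + (norm (x - c))\<^sup>2 / (2 * lam)"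
  define U where "U = a + (norm (u - c))\<^sup>2 / (2 * lam)"
  define Q where "Q = (1 + lam * \<mu>) / (2 * lam) * (norm (u - x))\<^sup>2"
  have xV: "x \<in> V" using x by (simp add: is_arg_min_def)
  have *: "X + (1 - s) * Q \<le> U" if s: "0 < s" "s < 1" for s
  proof -
    let ?z = "(1 - s) *\<^sub>R x + s *\<^sub>R u"
    have z: "?z \<in> V" and le: "\<Psi> ?z
        \<le> ereal ((1 - s) * g + s * a - \<mu> / 2 * (s * (1 - s) * (norm (u - x))\<^sup>2))"
      using Conv_combination[OF \<Psi> xV _ u, of g s] gx s by auto
    have "prox_obj \<Psi> lam c x \<le> prox_obj \<Psi> lam c ?z"
      using x z by (auto simp: is_arg_min_def not_less)
    also have "\<dots> \<le> ereal ((1 - s) * g + s * a - \<mu> / 2 * (s * (1 - s) * (norm (u - x))\<^sup>2))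
        + ereal ((norm (?z - c))\<^sup>2 / (2 * lam))"
      unfolding prox_obj_def by (intro add_right_mono le)
    finally have "X \<le> (1 - s) * g + s * a - \<mu> / 2 * (s * (1 - s) * (norm (u - x))\<^sup>2)
        + (norm (?z - c))\<^sup>2 / (2 * lam)"
      by (simp add: prox_obj_def gx X_def)
    also have "\<dots> = (1 - s) * X + s * U - s * ((1 - s) * Q)"
      unfolding norm_convex_combination_sq X_def U_def Q_def using lam by (simp add: field_simps)
    finally have "s * (X + (1 - s) * Q) \<le> s * U" by (simp add: algebra_simps)
    then show ?thesis using s by simp
  qed
  have "((\<lambda>s. X + (1 - s) * Q) \<longlongrightarrow> X + (1 - 0) * Q) (at_right (0::real))"
    by (intro tendsto_intros)
  moreover have "\<forall>\<^sub>F s in at_right 0. X + (1 - s) * Q \<le> U"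
    by (rule eventually_mono[OF eventually_at_right_real[of 0 1]]) (use * in auto)
  ultimately have "X + (1 - 0) * Q \<le> U"
    by (intro tendsto_upperbound[of _ _ "at_right 0"]) auto
  then show ?thesis by (simp add: X_def U_def Q_def)
qed

section \<open>Counting iterations of a restarted contraction\<close>

text \<open>
  The bookkeeping of cycles, separated from optimization. In the application \<open>D j\<close> and \<open>E j\<close> are the
  squared distances of the iterate and of the prox center to a solution, \<open>a\<close> is \<open>\<epsilon> lam\<close>, and \<open>l\<close>
  bounds the length of a cycle: one serious update, \<open>n\<close> contractions after which the gap is
  still above \<open>e / 2\<close>, and one more null update. The bound \<open>Tb\<close> on the gap at the start of a cycle
  may rely on \<open>D j \<le> D 0\<close>, since the distances have not grown when the cycle starts.
\<close>

lemma restarted_contraction_count: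
  fixes t D E :: "nat \<Rightarrow> real" and \<theta> a e \<tau> Tb l :: real
  assumes t0: "t 0 \<le> e / 2" and e: "0 < e" and \<tau>: "0 \<le> \<tau>" and \<theta>: "1 \<le> \<theta>" and a: "0 \<le> a"
    and D: "\<And>j. 0 \<le> D j"
    and serious_center: "\<And>j. t j \<le> e / 2 \<Longrightarrow> E (Suc j) = D j"
    and serious_gap: "\<And>j. t j \<le> e / 2 \<Longrightarrow> D j \<le> D 0 \<Longrightarrow> t (Suc j) \<le> Tb"
    and null_center: "\<And>j. t j > e / 2 \<Longrightarrow> E (Suc j) = E j"
    and null_gap: "\<And>j. t j > e / 2 \<Longrightarrow> t (Suc j) \<le> \<tau> * t j + (1 - \<tau>) * (e / 4)"
    and descent: "\<And>j. j < N \<Longrightarrow> t (Suc j) \<le> e / 2 \<Longrightarrow> \<theta> * D (Suc j) + a \<le> E (Suc j)"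
    and l1: "1 \<le> l" and l: "\<And>n. \<tau> ^ n * Tb > e / 4 \<Longrightarrow> real n + 2 \<le> l"
  shows "\<exists>k. real N \<le> (real k + 1) * l \<and> a * (\<Sum>i<k. \<theta> ^ i) \<le> D 0"
proof -
  \<comment> \<open>\<open>i\<close> is the iteration whose iterate is the center of the cycle that is current after \<open>j\<close> (if \<open>j\<close> has
    just closed a cycle, \<open>i = j\<close>), and \<open>k\<close> is the number of cycles closed up to \<open>i\<close>.\<close>
  define inv where "inv j i k \<longleftrightarrow> i \<le> j \<and> real i \<le> real k * l \<and>
    \<theta> ^ k * D i + a * (\<Sum>i<k. \<theta> ^ i) \<le> D 0 \<and>
    (i = j \<and> t j \<le> e / 2 \<or>
     i < j \<and> t j > e / 2 \<and> E j = D i \<and> t j - e / 4 \<le> \<tau> ^ (j - i - 1) * (Tb - e / 4))" for j i k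
  have len: "real j - real i + 1 \<le> l"
    if "i < j" "t j > e / 2" "t j - e / 4 \<le> \<tau> ^ (j - i - 1) * (Tb - e / 4)" for i j
  proof -
    have "e / 4 < \<tau> ^ (j - i - 1) * (Tb - e / 4)" using that by linarith
    also have "\<dots> \<le> \<tau> ^ (j - i - 1) * Tb" using e \<tau> by (intro mult_left_mono) auto
    finally have "real (j - i - 1) + 2 \<le> l" by (rule l)
    then show ?thesis using that(1) by (simp add: of_nat_diff)
  qed
  have restart: "\<theta> ^ Suc k * D j + a * (\<Sum>i<Suc k. \<theta> ^ i) \<le> D 0"
    if "\<theta> * D j + a \<le> D i" "\<theta> ^ k * D i + a * (\<Sum>i<k. \<theta> ^ i) \<le> D 0" for i j k
  proof -
    have "\<theta> ^ k * (\<theta> * D j + a) \<le> \<theta> ^ k * D i" using that(1) \<theta> by (intro mult_left_mono) auto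
    then show ?thesis using that(2) by (simp add: algebra_simps)
  qed
  have "\<exists>i k. inv j i k" if "j \<le> N" for j
    using that
  proof (induction j)
    case 0
    have "inv 0 0 0" using t0 by (simp add: inv_def)
    then show ?case by blast
  next
    case (Suc j)
    then obtain i k where ik: "inv j i k" by auto
    have pos: "\<theta> ^ k * D i + a * (\<Sum>i<k. \<theta> ^ i) \<le> D 0" and ikl: "real i \<le> real k * l"
      using ik by (auto simp: inv_def)
    show ?case
    proof (cases "t j \<le> e / 2")
      case True
      then have ij: "i = j" using ik by (auto simp: inv_def)
      have "1 * D i \<le> \<theta> ^ k * D i" using D \<theta> by (intro mult_right_mono) auto
      moreover have "0 \<le> a * (\<Sum>i<k. \<theta> ^ i)" using a \<theta> by (intro mult_nonneg_nonneg sum_nonneg) auto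
      ultimately have "D i \<le> D 0" using pos by linarith
      then have "D j \<le> D 0" using ij by simp
      then have tb: "t (Suc j) \<le> Tb" and c: "E (Suc j) = D i"
        using serious_gap serious_center True ij by auto
      show ?thesis
      proof (cases "t (Suc j) \<le> e / 2")
        case t: True
        have "\<theta> * D (Suc j) + a \<le> D i" using descent[of j] t c Suc.prems by simp
        then have "inv (Suc j) (Suc j) (Suc k)"
          using restart[of "Suc j" i k] pos ikl ij l1 t by (auto simp: inv_def algebra_simps)
        then show ?thesis by blast
      next
        case False
        then have "inv (Suc j) i k" using ik ij c tb by (auto simp: inv_def)
        then show ?thesis by blast
      qed
    next
      case False
      then have ij: "i < j" and tj: "t j > e / 2" and c: "E (Suc j) = D i"
        and g: "t j - e / 4 \<le> \<tau> ^ (j - i - 1) * (Tb - e / 4)"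
        using ik null_center[of j] by (auto simp: inv_def)
      have "t (Suc j) - e / 4 \<le> \<tau> * (t j - e / 4)"
        using null_gap[OF tj] by (simp add: algebra_simps diff_divide_distrib)
      also have "\<dots> \<le> \<tau> * (\<tau> ^ (j - i - 1) * (Tb - e / 4))" using g \<tau> by (rule mult_left_mono)
      also have "\<dots> = \<tau> ^ (Suc j - i - 1) * (Tb - e / 4)"
        using ij by (simp add: Suc_diff_Suc flip: power_Suc mult.assoc)
      finally have g': "t (Suc j) - e / 4 \<le> \<tau> ^ (Suc j - i - 1) * (Tb - e / 4)" .
      show ?thesis
      proof (cases "t (Suc j) \<le> e / 2")
        case t: True
        have "\<theta> * D (Suc j) + a \<le> D i" using descent[of j] t c Suc.prems by simp
        then have "inv (Suc j) (Suc j) (Suc k)"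
          using restart[of "Suc j" i k] pos ikl len[OF ij tj g] t
          by (auto simp: inv_def algebra_simps)
        then show ?thesis by blast
      next
        case False
        then have "inv (Suc j) i k" using ij c g' pos ikl by (auto simp: inv_def)
        then show ?thesis by blast
      qed
    qed
  qed
  then obtain i k where ik: "inv N i k" by blast
  have "real N \<le> (real k + 1) * l"
    using ik len[of i N] l1 by (auto simp: inv_def algebra_simps)
  moreover have "0 \<le> \<theta> ^ k * D i" using D \<theta> by simp
  ultimately show ?thesis using ik by (intro exI[of _ k]) (auto simp: inv_def)
qed

section \<open>One run of the bundle method\<close>

text \<open>A run for one fixed \<open>\<tau>\<close>, with any pair \<open>(M, L)\<close> satisfying the Lipschitz-type condition and any
  solution \<open>xs\<close>.\<close>

locale GPB_run =
  fixes V :: "'a::real_inner set" and f h :: "'a \<Rightarrow> ereal" and f' :: "'a \<Rightarrow> 'a"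
    and M L \<mu> lam \<epsilon> \<tau> :: real and x0 xs :: 'a
    and x xc y :: "nat \<Rightarrow> 'a" and \<Gamma> :: "nat \<Rightarrow> 'a \<Rightarrow> ereal" and m t :: "nat \<Rightarrow> ereal"
  assumes f: "f \<in> Conv V 0" and h: "h \<in> Conv V \<mu>"
    and dom: "edom V h \<subseteq> edom V f"
    and f': "\<And>u. u \<in> edom V h \<Longrightarrow> f' u \<in> subdifferential V f u"
    and A3: "A3 V f' h M L"
    and nonneg: "0 \<le> M" "0 \<le> L" "0 \<le> \<mu>" and pos: "0 < lam" "0 < \<epsilon>"
    and \<tau>: "0 < \<tau>" "\<tau> < 1"
    and \<tau>_large: "8 * lam * (M\<^sup>2 + \<epsilon> * L) / ((1 + lam * \<mu>) * \<epsilon>) \<le> \<tau> / (1 - \<tau>)"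
    and xs: "is_argmin_on V (phi f h) xs"
    and x0: "x0 \<in> edom V h"
    and GPB: "GPB V f f' h \<mu> x0 lam \<epsilon> \<tau> x xc y \<Gamma> m t"
begin

definition \<phi> :: "'a \<Rightarrow> real" where "\<phi> u = real_of_ereal (phi f h u)"

lemma edom_V: "u \<in> edom V h \<Longrightarrow> u \<in> V"
  by (simp add: edom_def)

lemma f_finite: "u \<in> edom V h \<Longrightarrow> \<bar>f u\<bar> \<noteq> \<infinity>"
  using f dom unfolding Conv_def proper_on_def edom_def by fastforce

lemma h_finite: "u \<in> edom V h \<Longrightarrow> \<bar>h u\<bar> \<noteq> \<infinity>"
  using h unfolding Conv_def proper_on_def edom_def by fastforce

lemma phi_eq: "u \<in> edom V h \<Longrightarrow> phi f h u = ereal (\<phi> u)"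
  using f_finite[of u] h_finite[of u] unfolding \<phi>_def phi_def by (auto simp: ereal_real)

lemma phi_infinite:
  assumes "u \<in> V" "u \<notin> edom V h"
  shows "phi f h u = \<infinity>"
  using assms f unfolding phi_def edom_def Conv_def proper_on_def by (auto simp: not_less)

lemma lin_finite: "v \<in> edom V h \<Longrightarrow> \<bar>lin f f' u v\<bar> \<noteq> \<infinity>"
  using f_finite[of v] unfolding lin_def by auto

lemma lin_plus_h_infinite:
  assumes "v \<in> edom V h" "u \<in> V" "u \<notin> edom V h"
  shows "lin f f' u v + h u = \<infinity>"
  using assms lin_finite[of v u] by (auto simp: edom_def not_less)

text \<open>The subgradient inequality at \<open>u\<close> bounds the loss by \<open>inner (f' u - f' v) (u - v)\<close>. Integrating
  along the segment would give \<open>L / 2\<close> in place of \<open>L\<close>; the constant in the condition on \<open>\<tau>\<close> leaves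
  room for the cruder estimate.\<close>

lemma lin_lower:
  assumes u: "u \<in> edom V h" and v: "v \<in> edom V h"
  shows "ereal (\<phi> u - 2 * M * norm (u - v) - L * (norm (u - v))\<^sup>2) \<le> lin f f' u v + h u"
proof -
  obtain fu fv hu where eq: "f u = ereal fu" "f v = ereal fv" "h u = ereal hu"
    using f_finite[OF u] f_finite[OF v] h_finite[OF u] by (metis ereal_real')
  then have \<phi>: "\<phi> u = fu + hu" by (simp add: \<phi>_def phi_def)
  have "f u + ereal (inner (f' u) (v - u)) \<le> f v"
    using f'[OF u] edom_V[OF v] by (simp add: subdifferential_def)
  then have "fu + inner (f' u) (v - u) \<le> fv" by (simp add: eq)
  then have "fu - (fv + inner (f' v) (u - v)) \<le> inner (f' u - f' v) (u - v)"
    by (simp add: inner_diff_left inner_diff_right)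
  also have "\<dots> \<le> norm (f' u - f' v) * norm (u - v)" by (rule norm_cauchy_schwarz)
  also have "\<dots> \<le> (2 * M + L * norm (u - v)) * norm (u - v)"
    using A3 u v by (intro mult_right_mono) (auto simp: A3_def)
  finally show ?thesis by (simp add: lin_def eq \<phi> power2_eq_square algebra_simps)
qed

lemma xs_dom: "xs \<in> edom V h"
proof (rule ccontr)
  assume n: "xs \<notin> edom V h"
  have "xs \<in> V" "\<not> phi f h x0 < phi f h xs"
    using xs edom_V[OF x0] by (auto simp: is_arg_min_def)
  then show False using phi_infinite[of xs] phi_eq[OF x0] n by simp
qed

lemma \<phi>_min: "u \<in> edom V h \<Longrightarrow> \<phi> xs \<le> \<phi> u"
  using xs phi_eq[of u] phi_eq[OF xs_dom] edom_V[of u] by (fastforce simp: is_arg_min_def not_less)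

lemma phi_opt_eq: "phi_opt V f h = ereal (\<phi> xs)"
  unfolding phi_opt_def
proof (rule INF_eqI)
  show "ereal (\<phi> xs) \<le> phi f h u" if "u \<in> V" for u
    using that phi_eq[OF xs_dom] xs by (auto simp: is_arg_min_def not_less)
  show "z \<le> ereal (\<phi> xs)" if "\<And>u. u \<in> V \<Longrightarrow> z \<le> phi f h u" for z
    using that[of xs] xs_dom edom_V phi_eq by auto
qed

lemma
  shows x_0: "x 0 = x0" and y_0: "y 0 = x0" and t_0: "t 0 = 0"
    and x_argmin: "is_argmin_on V (prox_obj (\<Gamma> (Suc j)) lam (xc (Suc j))) (x (Suc j))"
    and y_argmin: "is_argmin_on (x ` {0..Suc j}) (phi f h) (y (Suc j))"
    and m_eq: "m (Suc j) = prox_obj (\<Gamma> (Suc j)) lam (xc (Suc j)) (x (Suc j))"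
    and t_step: "t (Suc j) = phi f h (y (Suc j)) - m (Suc j)"
    and model_Conv: "\<Gamma> (Suc j) \<in> Conv V \<mu>" and model_le_phi: "u \<in> V \<Longrightarrow> \<Gamma> (Suc j) u \<le> phi f h u"
  using GPB[unfolded GPB_def] spec[of _ "Suc j"] by (auto split: if_splits)

lemma serious:
  assumes "t j \<le> ereal (\<epsilon> / 2)"
  shows "xc (Suc j) = x j" and "u \<in> V \<Longrightarrow> lin f f' u (x j) + h u \<le> \<Gamma> (Suc j) u"
  using GPB[unfolded GPB_def] assms by (auto dest: spec[of _ "Suc j"])

lemma null:
  assumes "\<not> t j \<le> ereal (\<epsilon> / 2)"
  obtains \<Gamma>b where "xc (Suc j) = xc j" "\<Gamma>b \<in> Conv V \<mu>" "\<Gamma>b (x j) = \<Gamma> j (x j)"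
    "is_argmin_on V (prox_obj \<Gamma>b lam (xc j)) (x j)"
    "\<And>u. u \<in> V \<Longrightarrow>
      ereal \<tau> * \<Gamma>b u + ereal (1 - \<tau>) * (lin f f' u (x j) + h u) \<le> \<Gamma> (Suc j) u"
proof -
  have "xc (Suc j) = xc j \<and> (\<exists>\<Gamma>b\<in>Conv V \<mu>. \<Gamma>b (x j) = \<Gamma> j (x j) \<and>
      is_argmin_on V (prox_obj \<Gamma>b lam (xc j)) (x j) \<and>
      (\<forall>u\<in>V. ereal \<tau> * \<Gamma>b u + ereal (1 - \<tau>) * (lin f f' u (x j) + h u) \<le> \<Gamma> (Suc j) u \<and>
        \<Gamma> (Suc j) u \<le> phi f h u))"
    using GPB[unfolded GPB_def, THEN conjunct2, THEN conjunct2, THEN conjunct2, THEN spec, of "Suc j"]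
      assms by simp
  then show thesis using that by blast
qed

lemma model_finite: "\<bar>\<Gamma> (Suc j) (x (Suc j))\<bar> \<noteq> \<infinity>" and x_Suc_V: "x (Suc j) \<in> V"
  using prox_argmin_finite[OF model_Conv x_argmin] by auto

text \<open>An infinite value of \<open>h\<close> at an iterate would make the model infinite at its own prox point,
  since the lower bound prescribed for the model gives \<open>h\<close> a positive weight.\<close>

lemma x_dom: "x j \<in> edom V h"
proof (induction j)
  case 0
  then show ?case using x0 x_0 by simp
next
  case (Suc j)
  show ?case
  proof (rule ccontr)
    assume "x (Suc j) \<notin> edom V h"
    then have inf: "lin f f' (x (Suc j)) (x j) + h (x (Suc j)) = \<infinity>"
      using lin_plus_h_infinite Suc x_Suc_V by blast
    show False
    proof (cases "t j \<le> ereal (\<epsilon> / 2)")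
      case True
      then show False using serious(2)[OF True x_Suc_V[of j]] inf model_finite[of j] by auto
    next
      case False
      then obtain \<Gamma>b where \<Gamma>b: "\<Gamma>b \<in> Conv V \<mu>" "ereal \<tau> * \<Gamma>b (x (Suc j)) + ereal (1 - \<tau>) *
          (lin f f' (x (Suc j)) (x j) + h (x (Suc j))) \<le> \<Gamma> (Suc j) (x (Suc j))"
        using null x_Suc_V by metis
      have "\<Gamma>b (x (Suc j)) \<noteq> -\<infinity>" using \<Gamma>b(1) x_Suc_V unfolding Conv_def proper_on_def by auto
      then have "ereal \<tau> * \<Gamma>b (x (Suc j)) \<noteq> -\<infinity>" using \<tau> by (cases "\<Gamma>b (x (Suc j))") auto
      then show False using \<Gamma>b(2) inf \<tau> model_finite[of j] by auto
    qed
  qed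
qed

text \<open>From here on all quantities are real: \<open>model_min j\<close> is \<open>m j\<close> for \<open>j \<ge> 1\<close>, and \<open>gap j\<close> is \<open>t j\<close> for all
  \<open>j\<close>.\<close>

definition model_val :: "nat \<Rightarrow> real" where "model_val j = real_of_ereal (\<Gamma> j (x j))"
definition model_min :: "nat \<Rightarrow> real" where "model_min j = model_val j + (norm (x j - xc j))\<^sup>2 / (2 * lam)"
definition gap :: "nat \<Rightarrow> real" where "gap j = real_of_ereal (t j)"

lemma model_eq: "\<Gamma> (Suc j) (x (Suc j)) = ereal (model_val (Suc j))"
  using model_finite[of j] by (simp add: model_val_def ereal_real')

lemma y_mem: "\<exists>i\<le>j. y j = x i"
proof (cases j)
  case (Suc k)
  have "y (Suc k) \<in> x ` {0..Suc k}" using y_argmin[of k] by (simp add: is_arg_min_def)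
  then show ?thesis using Suc by auto
qed (use x_0 y_0 in auto)

lemma y_dom: "y j \<in> edom V h"
  using y_mem[of j] x_dom by auto

lemma y_min: "i \<le> j \<Longrightarrow> \<phi> (y j) \<le> \<phi> (x i)"
proof (cases j)
  case (Suc k)
  assume "i \<le> j"
  then have "\<not> phi f h (x i) < phi f h (y j)"
    using y_argmin[of k] Suc by (auto simp: is_arg_min_def)
  then show ?thesis using phi_eq[OF x_dom] phi_eq[OF y_dom] by simp
qed (use x_0 y_0 in auto)

lemma t_Suc: "t (Suc j) = ereal (\<phi> (y (Suc j)) - model_min (Suc j))"
  using m_eq[of j] t_step[of j] model_eq[of j] phi_eq[OF y_dom[of "Suc j"]]
  by (simp add: prox_obj_def model_min_def)

lemma gap_Suc: "gap (Suc j) = \<phi> (y (Suc j)) - model_min (Suc j)"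
  by (simp add: gap_def t_Suc)

lemma t_eq: "t j = ereal (gap j)"
  by (cases j) (simp_all add: gap_def t_0 t_Suc)

lemma gap_0: "gap 0 = 0"
  by (simp add: gap_def t_0)

lemma eps_solution_iff: "eps_solution V f h \<epsilon> (y j) \<longleftrightarrow> \<phi> (y j) - \<phi> xs \<le> \<epsilon>"
  using y_dom[of j] phi_eq[OF y_dom[of j]] by (simp add: eps_solution_def phi_opt_eq)

text \<open>Writing \<open>r\<close> for the length of the step and \<open>\<theta> = 1 + lam \<mu>\<close>, the part \<open>\<Gamma>b\<close> of the new model
  contributes the growth \<open>\<tau> \<theta> r\<^sup>2 / (2 lam)\<close> and the new linearization costs
  \<open>(1 - \<tau>) (2 M r + L r\<^sup>2)\<close>; completing a square shows that the difference is at least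
  \<open>- (1 - \<tau>) \<epsilon> / 4\<close>.\<close>

lemma null_gap:
  assumes "gap j > \<epsilon> / 2"
  shows "gap (Suc j) \<le> \<tau> * gap j + (1 - \<tau>) * (\<epsilon> / 4)" and "xc (Suc j) = xc j"
proof -
  have nt: "\<not> t j \<le> ereal (\<epsilon> / 2)" using assms by (simp add: t_eq)
  then obtain i where i: "j = Suc i" using pos gap_0 t_eq by (cases j) auto
  obtain \<Gamma>b where xc: "xc (Suc j) = xc j" and \<Gamma>b: "\<Gamma>b \<in> Conv V \<mu>" "\<Gamma>b (x j) = \<Gamma> j (x j)"
    "is_argmin_on V (prox_obj \<Gamma>b lam (xc j)) (x j)"
    and le: "\<And>u. u \<in> V \<Longrightarrow>
      ereal \<tau> * \<Gamma>b u + ereal (1 - \<tau>) * (lin f f' u (x j) + h u) \<le> \<Gamma> (Suc j) u"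
    using null[OF nt] by metis
  show "xc (Suc j) = xc j" by (fact xc)
  let ?v = "x (Suc j)"
  let ?r = "norm (?v - x j)"
  define w where "w = \<phi> ?v - 2 * M * ?r - L * ?r\<^sup>2"
  have v: "?v \<in> V" using x_Suc_V .
  have "ereal w \<le> lin f f' ?v (x j) + h ?v"
    unfolding w_def by (rule lin_lower[OF x_dom x_dom])
  then have "ereal \<tau> * \<Gamma>b ?v + ereal (1 - \<tau>) * ereal w
      \<le> ereal \<tau> * \<Gamma>b ?v + ereal (1 - \<tau>) * (lin f f' ?v (x j) + h ?v)"
    using \<tau> by (intro add_left_mono ereal_mult_left_mono) auto
  also have "\<dots> \<le> ereal (model_val (Suc j))" using le[OF v] by (simp add: model_eq)
  finally have b: "ereal \<tau> * \<Gamma>b ?v + ereal (1 - \<tau>) * ereal w \<le> ereal (model_val (Suc j))" .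
  have "\<Gamma>b ?v \<noteq> -\<infinity>" using \<Gamma>b(1) v unfolding Conv_def proper_on_def by auto
  moreover have "\<Gamma>b ?v \<noteq> \<infinity>" using b \<tau> by auto
  ultimately obtain b where gb: "\<Gamma>b ?v = ereal b" by (cases "\<Gamma>b ?v") auto
  have 1: "\<tau> * b + (1 - \<tau>) * w \<le> model_val (Suc j)" using b by (simp add: gb)
  define \<theta> where "\<theta> = 1 + lam * \<mu>"
  define q where "q = (norm (?v - xc j))\<^sup>2 / (2 * lam)"
  define B where "B = \<theta> / (2 * lam)"
  define K where "K = 4 * (M\<^sup>2 / \<epsilon> + L)"
  define e where "e = \<epsilon> / 4"
  have 2: "model_min j + B * ?r\<^sup>2 \<le> b + q"
    using prox_three_point[OF \<Gamma>b(1) pos(1) \<Gamma>b(3) _ v, of "model_val j" b] \<Gamma>b(2) gb model_eq[of i]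
    by (simp add: model_min_def i B_def \<theta>_def q_def)
  have \<theta>: "0 < \<theta>" using nonneg pos by (simp add: \<theta>_def add_pos_nonneg)
  have cross: "p * s \<le> r * q" if "p / q \<le> r / s" "0 < q" "0 < s" for p q r s :: real
    using that by (simp add: field_simps)
  have "8 * lam * (M\<^sup>2 + \<epsilon> * L) * (1 - \<tau>) \<le> \<tau> * (\<theta> * \<epsilon>)"
    using cross[OF \<tau>_large] \<tau> \<theta> pos by (simp add: \<theta>_def)
  then have "(1 - \<tau>) * K \<le> \<tau> * B"
    using pos by (simp add: K_def B_def field_simps)
  then have "(1 - \<tau>) * K * ?r\<^sup>2 \<le> \<tau> * B * ?r\<^sup>2"
    by (rule mult_right_mono) simp
  \<comment> \<open>Young's inequality \<open>2 M r \<le> 4 M\<^sup>2 r\<^sup>2 / \<epsilon> + \<epsilon> / 4\<close>, in the form of a perfect square\<close>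
  moreover have "(1 - \<tau>) * (2 * M * ?r + L * ?r\<^sup>2 - e) \<le> (1 - \<tau>) * (K * ?r\<^sup>2)"
  proof (intro mult_left_mono)
    have "0 \<le> (4 * M * ?r - \<epsilon>)\<^sup>2 / (4 * \<epsilon>)" using pos by simp
    also have "\<dots> = 4 * (M\<^sup>2 / \<epsilon>) * ?r\<^sup>2 - 2 * M * ?r + e"
      using pos by (simp add: e_def power2_eq_square field_simps)
    finally have "2 * M * ?r - e \<le> 4 * (M\<^sup>2 / \<epsilon>) * ?r\<^sup>2" by simp
    moreover have "0 \<le> L * ?r\<^sup>2" using nonneg by simp
    ultimately show "2 * M * ?r + L * ?r\<^sup>2 - e \<le> K * ?r\<^sup>2"
      by (simp add: K_def algebra_simps)
  qed (use \<tau> in simp)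
  moreover have "\<tau> * (model_min j + B * ?r\<^sup>2) \<le> \<tau> * (b + q)"
    using 2 \<tau> by (intro mult_left_mono) auto
  moreover have "0 \<le> (1 - \<tau>) * q" using \<tau> pos by (simp add: q_def)
  ultimately have "\<tau> * model_min j + (1 - \<tau>) * (\<phi> ?v - e) \<le> model_val (Suc j) + q"
    using 1 by (simp add: w_def algebra_simps)
  then have 3: "\<tau> * model_min j + (1 - \<tau>) * (\<phi> ?v - e) \<le> model_min (Suc j)"
    by (simp add: model_min_def xc q_def)
  have "\<phi> (y (Suc j)) \<le> \<phi> (y j)" using y_min y_mem[of j] by (metis le_SucI)
  then have "\<tau> * \<phi> (y (Suc j)) \<le> \<tau> * \<phi> (y j)" using \<tau> by simp
  moreover have "(1 - \<tau>) * \<phi> (y (Suc j)) \<le> (1 - \<tau>) * \<phi> ?v"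
    using y_min[of "Suc j" "Suc j"] \<tau> by (intro mult_left_mono) auto
  moreover have tj: "gap j = \<phi> (y j) - model_min j" using gap_Suc[of i] i by simp
  ultimately show "gap (Suc j) \<le> \<tau> * gap j + (1 - \<tau>) * (\<epsilon> / 4)"
    using 3 by (simp add: gap_Suc tj e_def[symmetric] algebra_simps)
qed

text \<open>The model is below the optimal value at \<open>xs\<close>, while its minimal prox value is at
  least \<open>\<phi> (y (Suc j)) - \<epsilon> / 2\<close>, which exceeds \<open>\<phi> xs + \<epsilon> / 2\<close> if \<open>y (Suc j)\<close> is not an \<open>\<epsilon>\<close>-solution.\<close>

lemma descent:
  assumes "gap (Suc j) \<le> \<epsilon> / 2" "\<not> eps_solution V f h \<epsilon> (y (Suc j))"
  shows "(1 + lam * \<mu>) * (norm (xs - x (Suc j)))\<^sup>2 + \<epsilon> * lam \<le> (norm (xs - xc (Suc j)))\<^sup>2"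
proof -
  have "\<Gamma> (Suc j) xs \<le> ereal (\<phi> xs)" using model_le_phi xs_dom edom_V phi_eq by metis
  from prox_three_point[OF model_Conv pos(1) x_argmin model_eq edom_V[OF xs_dom] this]
  have "model_min (Suc j) + (1 + lam * \<mu>) / (2 * lam) * (norm (xs - x (Suc j)))\<^sup>2
      \<le> \<phi> xs + (norm (xs - xc (Suc j)))\<^sup>2 / (2 * lam)" by (simp add: model_min_def)
  then have "\<epsilon> / 2 + (1 + lam * \<mu>) / (2 * lam) * (norm (xs - x (Suc j)))\<^sup>2
      \<le> (norm (xs - xc (Suc j)))\<^sup>2 / (2 * lam)"
    using assms by (simp add: eps_solution_iff gap_Suc)
  moreover have "\<epsilon> / 2 + (1 + lam * \<mu>) / (2 * lam) * (norm (xs - x (Suc j)))\<^sup>2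
      = ((1 + lam * \<mu>) * (norm (xs - x (Suc j)))\<^sup>2 + \<epsilon> * lam) / (2 * lam)"
    using pos by (simp add: field_simps)
  ultimately show ?thesis using pos by (simp add: divide_le_cancel)
qed

text \<open>
  The prox inequality at \<open>xs\<close> bounds the step as soon as the model value at the new iterate is
  bounded below. Using \<open>lin_lower\<close> at the new iterate itself costs \<open>L r\<^sup>2\<close>, which the term
  \<open>r\<^sup>2 / (2 lam)\<close> absorbs only when \<open>lam L\<close> is small. So \<open>lin_lower\<close> is used at the point \<open>z\<close> that lies at a fraction
  \<open>1 / A\<close> of the way from \<open>xs\<close> to the new iterate, and convexity of the model carries the bound over:
  it is multiplied by \<open>A\<close>, but the quadratic term in \<open>r\<close> becomes \<open>L r\<^sup>2 / A\<close> up to a constant.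
  Taking \<open>A\<close> proportional to \<open>max 1 (lam L)\<close> makes it harmless.
\<close>

lemma serious_step_length:
  assumes "gap j \<le> \<epsilon> / 2"
  shows "norm (x (Suc j) - x j) \<le> 8 * (max 1 (2 * lam * L) * norm (xs - x j) + lam * M)"
proof -
  have tj: "t j \<le> ereal (\<epsilon> / 2)" using assms by (simp add: t_eq)
  note xc = serious(1)[OF tj]
  define r where "r = norm (x (Suc j) - x j)"
  define d where "d = norm (xs - x j)"
  define A where "A = max 1 (8 * lam * L)"
  define z where "z = (1 - 1 / A) *\<^sub>R xs + (1 / A) *\<^sub>R x (Suc j)"
  define w where "w = norm (z - x j)"
  have A: "1 \<le> A" "8 * lam * L \<le> A" by (auto simp: A_def)
  have rd: "0 \<le> r" "0 \<le> d" "0 \<le> w" by (simp_all add: r_def d_def w_def)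
  have \<Gamma>xs: "\<Gamma> (Suc j) xs \<le> ereal (\<phi> xs)" using model_le_phi xs_dom edom_V phi_eq by metis
  have zV: "z \<in> V" and "\<Gamma> (Suc j) z \<le> ereal ((1 - 1 / A) * \<phi> xs + 1 / A * model_val (Suc j)
      - \<mu> / 2 * (1 / A * (1 - 1 / A) * (norm (x (Suc j) - xs))\<^sup>2))"
    using Conv_combination[OF model_Conv[of j] edom_V[OF xs_dom] \<Gamma>xs x_Suc_V[of j], of "model_val (Suc j)" "1 / A"]
      model_eq[of j] A unfolding z_def by auto
  note this(2)
  also have "\<dots> \<le> ereal ((1 - 1 / A) * \<phi> xs + 1 / A * model_val (Suc j))"
    using A nonneg by simp
  finally have \<Gamma>z: "\<Gamma> (Suc j) z \<le> ereal ((1 - 1 / A) * \<phi> xs + 1 / A * model_val (Suc j))" .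
  have linz: "lin f f' z (x j) + h z \<le> \<Gamma> (Suc j) z" by (rule serious(2)[OF tj zV])
  have zd: "z \<in> edom V h"
    using lin_plus_h_infinite[OF x_dom zV, of j] linz \<Gamma>z by (metis ereal_infty_less_eq(1) PInfty_neq_ereal(1))
  have "\<phi> z - 2 * M * w - L * w\<^sup>2 \<le> (1 - 1 / A) * \<phi> xs + 1 / A * model_val (Suc j)"
    using order_trans[OF order_trans[OF lin_lower[OF zd x_dom] linz] \<Gamma>z] by (simp add: w_def)
  then have "\<phi> xs - 2 * M * w - L * w\<^sup>2 \<le> (1 - 1 / A) * \<phi> xs + 1 / A * model_val (Suc j)"
    using \<phi>_min[OF zd] by linarith
  then have "1 / A * (\<phi> xs - model_val (Suc j)) \<le> 2 * M * w + L * w\<^sup>2"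
    by (simp add: algebra_simps)
  then have low: "\<phi> xs - model_val (Suc j) \<le> A * (2 * M * w + L * w\<^sup>2)"
    using A by (simp add: field_simps)
  have "model_val (Suc j) + r\<^sup>2 / (2 * lam) + (1 + lam * \<mu>) / (2 * lam) * (norm (xs - x (Suc j)))\<^sup>2
      \<le> \<phi> xs + d\<^sup>2 / (2 * lam)"
    using prox_three_point[OF model_Conv pos(1) x_argmin model_eq edom_V[OF xs_dom] \<Gamma>xs]
    by (simp add: xc r_def d_def)
  moreover have "0 \<le> (1 + lam * \<mu>) / (2 * lam) * (norm (xs - x (Suc j)))\<^sup>2"
    using pos nonneg by simp
  ultimately have "r\<^sup>2 / (2 * lam) \<le> A * (2 * M * w + L * w\<^sup>2) + d\<^sup>2 / (2 * lam)"
    using low by linarith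
  then have r2: "r\<^sup>2 \<le> d\<^sup>2 + 4 * (lam * M) * (A * w) + 2 * lam * L * (A * w\<^sup>2)"
    using pos by (simp add: field_simps)
  have "z - x j = (1 - 1 / A) *\<^sub>R (xs - x j) + (1 / A) *\<^sub>R (x (Suc j) - x j)"
    unfolding z_def by (simp add: algebra_simps)
  then have "w \<le> (1 - 1 / A) * d + 1 / A * r"
    using norm_triangle_ineq[of "(1 - 1 / A) *\<^sub>R (xs - x j)" "(1 / A) *\<^sub>R (x (Suc j) - x j)"] A
    by (simp add: w_def d_def r_def)
  also have "\<dots> \<le> 1 * d + 1 / A * r" using A rd by (intro add_right_mono mult_right_mono) auto
  finally have w: "w \<le> d + r / A" by simp
  have Aw: "A * w \<le> A * d + r" using mult_left_mono[OF w, of A] A by (simp add: algebra_simps)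
  have "w\<^sup>2 \<le> (d + r / A)\<^sup>2" using w rd by (intro power_mono)
  also have "\<dots> \<le> 2 * d\<^sup>2 + 2 * (r / A)\<^sup>2"
    using sum_squares_bound[of d "r / A"] unfolding power2_sum by linarith
  finally have "A * w\<^sup>2 \<le> A * (2 * d\<^sup>2 + 2 * (r / A)\<^sup>2)" using A by (intro mult_left_mono) auto
  also have "\<dots> = 2 * A * d\<^sup>2 + 2 * r\<^sup>2 / A" using A by (simp add: power2_eq_square field_simps)
  finally have "2 * lam * L * (A * w\<^sup>2) \<le> 2 * lam * L * (2 * A * d\<^sup>2 + 2 * r\<^sup>2 / A)"
    using pos nonneg by (intro mult_left_mono) auto
  also have "\<dots> = 8 * lam * L * (A * d\<^sup>2 / 2 + r\<^sup>2 / (2 * A))"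
    using A by (simp add: field_simps)
  also have "\<dots> \<le> A * (A * d\<^sup>2 / 2 + r\<^sup>2 / (2 * A))" using A by (intro mult_right_mono) auto
  also have "\<dots> = (A * d)\<^sup>2 / 2 + r\<^sup>2 / 2" using A by (simp add: power2_eq_square field_simps)
  finally have "2 * lam * L * (A * w\<^sup>2) \<le> (A * d)\<^sup>2 / 2 + r\<^sup>2 / 2" .
  moreover have "4 * (lam * M) * (A * w) \<le> 4 * (lam * M) * (A * d + r)"
    using Aw pos nonneg by (intro mult_left_mono) auto
  moreover have "d \<le> A * d" using A rd by (simp add: mult_le_cancel_right1)
  then have "d\<^sup>2 \<le> (A * d)\<^sup>2" using rd by (intro power_mono)
  ultimately have "r\<^sup>2 / 2 \<le> 3 / 2 * (A * d)\<^sup>2 + 4 * (lam * M) * (A * d + r)"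
    using r2 by linarith
  then have "(r - 4 * (lam * M))\<^sup>2 \<le> (2 * (A * d) + 4 * (lam * M))\<^sup>2
      - ((A * d)\<^sup>2 + 8 * (lam * M) * (A * d))"
    by (simp add: power2_eq_square algebra_simps)
  moreover have "0 \<le> (A * d)\<^sup>2 + 8 * (lam * M) * (A * d)" using A rd pos nonneg by simp
  ultimately have "(r - 4 * (lam * M))\<^sup>2 \<le> (2 * (A * d) + 4 * (lam * M))\<^sup>2" by linarith
  then have "r - 4 * (lam * M) \<le> 2 * (A * d) + 4 * (lam * M)"
    by (rule power2_le_imp_le) (use A rd pos nonneg in simp)
  moreover have "1 \<le> max 1 (2 * lam * L)" "2 * lam * L \<le> max 1 (2 * lam * L)" by simp_all
  then have "A \<le> 4 * max 1 (2 * lam * L)" unfolding A_def by linarith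
  then have "A * d \<le> 4 * max 1 (2 * lam * L) * d" using rd by (intro mult_right_mono)
  ultimately show ?thesis unfolding r_def[symmetric] d_def[symmetric] by (simp add: algebra_simps)
qed

lemma serious_gap:
  assumes tj: "gap j \<le> \<epsilon> / 2" and d0: "norm (xs - x j) \<le> d0"
  shows "gap (Suc j) \<le> 16 * tbar lam d0 M L"
proof -
  have t: "t j \<le> ereal (\<epsilon> / 2)" using tj by (simp add: t_eq)
  define r where "r = norm (x (Suc j) - x j)"
  define R where "R = max 1 (2 * lam * L) * d0 + lam * M"
  have "r \<le> 8 * (max 1 (2 * lam * L) * norm (xs - x j) + lam * M)"
    unfolding r_def by (rule serious_step_length[OF tj])
  also have "\<dots> \<le> 8 * R" unfolding R_def using d0 by (intro mult_left_mono add_right_mono) auto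
  finally have "r \<le> 8 * R" .
  then have r2: "r\<^sup>2 \<le> (8 * R)\<^sup>2" by (intro power_mono) (simp_all add: r_def)
  have "ereal (\<phi> (x (Suc j)) - 2 * M * r - L * r\<^sup>2) \<le> ereal (model_val (Suc j))"
    using order_trans[OF lin_lower[OF x_dom x_dom] serious(2)[OF t x_Suc_V]] model_eq
    unfolding r_def by metis
  then have "\<phi> (x (Suc j)) - model_val (Suc j) \<le> 2 * M * r + L * r\<^sup>2" by simp
  moreover have "model_val (Suc j) \<le> model_min (Suc j)" using pos by (simp add: model_min_def)
  moreover have "\<phi> (y (Suc j)) \<le> \<phi> (x (Suc j))" by (rule y_min) simp
  ultimately have "gap (Suc j) \<le> 2 * M * r + L * r\<^sup>2" by (simp add: gap_Suc)
  also have "\<dots> \<le> M\<^sup>2 + (L + 1) * r\<^sup>2"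
    using sum_squares_bound[of M r] by (simp add: algebra_simps)
  also have "\<dots> \<le> M\<^sup>2 + (L + 1) * (8 * R)\<^sup>2"
    using r2 nonneg by (intro add_left_mono mult_left_mono) auto
  also have "\<dots> \<le> 16 * tbar lam d0 M L"
  proof -
    have "tbar lam d0 M L = M\<^sup>2 + 4 * (L + 2) * R\<^sup>2" by (simp add: tbar_def R_def)
    moreover have "0 \<le> L * R\<^sup>2" using nonneg by simp
    ultimately show ?thesis by (simp add: algebra_simps power_mult_distrib)
  qed
  finally show ?thesis .
qed

text \<open>The length \<open>l\<close> of a cycle comes from \<open>\<tau> ^ n \<le> exp (- n (1 - \<tau>))\<close>: the excess of the gap over
  \<open>\<epsilon> / 4\<close>, at most \<open>Tb\<close> after the serious update, can stay above \<open>\<epsilon> / 4\<close> for at most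
  \<open>ln (4 Tb / \<epsilon>) / (1 - \<tau>)\<close> contractions.\<close>

lemma iteration_count:
  assumes none: "\<And>j. j \<le> N \<Longrightarrow> \<not> eps_solution V f h \<epsilon> (y j)"
    and l: "l = 2 + log_plus (4 * (16 * tbar lam (norm (x0 - xs)) M L) / \<epsilon>) / (1 - \<tau>)"
  shows "\<exists>k. real N \<le> (real k + 1) * l \<and>
    \<epsilon> * lam * (\<Sum>i<k. (1 + lam * \<mu>) ^ i) \<le> (norm (x0 - xs))\<^sup>2"
proof -
  let ?Tb = "16 * tbar lam (norm (x0 - xs)) M L"
  define s where "s = 4 * ?Tb / \<epsilon>"
  have Tb: "0 \<le> ?Tb" using nonneg by (simp add: tbar_def)
  have lp: "0 \<le> log_plus s" by (simp add: log_plus_def)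
  have ls: "l = 2 + log_plus s / (1 - \<tau>)" by (simp only: l s_def)
  have len: "real n + 2 \<le> l" if n: "\<tau> ^ n * ?Tb > \<epsilon> / 4" for n
  proof -
    have Tp: "0 < ?Tb" using n Tb pos \<tau> by (cases "?Tb = 0") auto
    then have sp: "0 < s" using pos by (simp add: s_def)
    have "\<tau> \<le> exp (\<tau> - 1)" using exp_ge_add_one_self[of "\<tau> - 1"] by simp
    then have "\<tau> ^ n \<le> exp (\<tau> - 1) ^ n" using \<tau> by (intro power_mono) auto
    then have "\<tau> ^ n * s \<le> exp (real n * (\<tau> - 1)) * s"
      using sp by (intro mult_right_mono) (auto simp: exp_of_nat_mult)
    moreover have "1 < \<tau> ^ n * s" using n pos by (simp add: s_def field_simps)
    ultimately have "0 < ln (exp (real n * (\<tau> - 1)) * s)" by simp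
    also have "\<dots> = real n * (\<tau> - 1) + ln s" using sp by (subst ln_mult) auto
    finally have "real n * (1 - \<tau>) \<le> log_plus s"
      using sp by (simp add: log_plus_def algebra_simps)
    then show ?thesis using \<tau> by (simp add: ls pos_le_divide_eq)
  qed
  have "\<exists>k. real N \<le> (real k + 1) * l \<and>
    \<epsilon> * lam * (\<Sum>i<k. (1 + lam * \<mu>) ^ i) \<le> (norm (xs - x 0))\<^sup>2"
  proof (rule restarted_contraction_count[where t = gap and e = \<epsilon> and \<tau> = \<tau> and Tb = ?Tb
        and D = "\<lambda>j. (norm (xs - x j))\<^sup>2" and E = "\<lambda>j. (norm (xs - xc j))\<^sup>2"])
    show "(norm (xs - xc (Suc j)))\<^sup>2 = (norm (xs - x j))\<^sup>2" if "gap j \<le> \<epsilon> / 2" for j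
      using that serious(1)[of j] by (simp add: t_eq)
    show "gap (Suc j) \<le> ?Tb" if "gap j \<le> \<epsilon> / 2" "(norm (xs - x j))\<^sup>2 \<le> (norm (xs - x 0))\<^sup>2" for j
      using serious_gap[OF that(1), of "norm (x0 - xs)"] power2_le_imp_le[OF that(2)]
      by (simp add: x_0 norm_minus_commute)
    show "(norm (xs - xc (Suc j)))\<^sup>2 = (norm (xs - xc j))\<^sup>2" if "gap j > \<epsilon> / 2" for j
      using null_gap(2)[OF that] by simp
    show "gap (Suc j) \<le> \<tau> * gap j + (1 - \<tau>) * (\<epsilon> / 4)" if "gap j > \<epsilon> / 2" for j
      by (rule null_gap(1)[OF that])
    show "(1 + lam * \<mu>) * (norm (xs - x (Suc j)))\<^sup>2 + \<epsilon> * lam \<le> (norm (xs - xc (Suc j)))\<^sup>2"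
      if "j < N" "gap (Suc j) \<le> \<epsilon> / 2" for j
      using that none[of "Suc j"] by (intro descent) auto
    show "real n + 2 \<le> l" if "\<tau> ^ n * ?Tb > \<epsilon> / 4" for n
      by (rule len[OF that])
    show "1 \<le> l" using lp \<tau> by (simp add: ls add_increasing2)
  qed (use pos \<tau> nonneg gap_0 in auto)
  then show ?thesis by (simp add: x_0 norm_minus_commute)
qed

end

section \<open>From cycle counts to the complexity bound\<close>

lemma log_plus_16_mult:
  assumes "0 \<le> s"
  shows "log_plus (16 * s) \<le> 3 + log_plus s"
proof (cases "s = 0")
  case False
  have "ln (16::real) = 4 * ln 2" using ln_realpow[of 2 4] by simp
  then have "ln (16::real) \<le> 3" using ln2_le_25_over_36 by simp
  then show ?thesis using False assms by (auto simp: log_plus_def ln_mult)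
qed (simp add: log_plus_def)

text \<open>
  Put \<open>\<theta> = 1 + lam \<mu>\<close> and \<open>\<kappa> = 8 lam T\<^sup>2 / (\<theta> \<epsilon>)\<close>; the two terms of the minimum are \<open>a\<close> and \<open>b\<close>.
  In \<open>k (1 + \<kappa>)\<close> the factor \<open>lam\<close> in \<open>\<kappa>\<close> cancels against the one in the bound on \<open>k\<close>, and the
  remaining \<open>1 / lam\<close> is controlled by the lower bound on \<open>lam\<close>. The unfinished last cycle adds
  \<open>1 + \<kappa>\<close>, where \<open>\<kappa>\<close> is controlled by the upper bound on \<open>lam\<close>.
\<close>

lemma cycles_le_complexity:
  fixes C \<epsilon> lam \<mu> T d0 :: real and k :: nat
  assumes pos: "0 < C" "0 < \<epsilon>" "0 < lam" "0 < T" and \<mu>: "0 \<le> \<mu>"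
    and lam1: "\<epsilon> / (C * T\<^sup>2) \<le> lam" and lam2: "lam \<le> C * d0\<^sup>2 / \<epsilon>"
    and k: "\<epsilon> * lam * (\<Sum>i<k. (1 + lam * \<mu>) ^ i) \<le> d0\<^sup>2"
  shows "(real k + 1) * (1 + 8 * lam * T\<^sup>2 / ((1 + lam * \<mu>) * \<epsilon>))
    \<le> (9 * C + 16) * complexity \<mu> \<epsilon> T d0"
proof -
  define \<theta> where "\<theta> = 1 + lam * \<mu>"
  define \<kappa> where "\<kappa> = 8 * lam * T\<^sup>2 / (\<theta> * \<epsilon>)"
  define a where "a = T\<^sup>2 * d0\<^sup>2 / \<epsilon>\<^sup>2"
  have \<theta>: "1 \<le> \<theta>" using pos \<mu> by (simp add: \<theta>_def)
  have T2: "0 < T\<^sup>2" using pos by simp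
  have \<kappa>0: "0 \<le> \<kappa>" using pos \<theta> by (simp add: \<kappa>_def)
  have a0: "0 \<le> a" by (simp add: a_def)
  have inv: "1 / lam \<le> C * T\<^sup>2 / \<epsilon>" using lam1 pos T2 by (simp add: field_simps)
  have "\<kappa> \<le> 8 * lam * T\<^sup>2 / (1 * \<epsilon>)"
    unfolding \<kappa>_def using \<theta> pos by (intro divide_left_mono mult_right_mono) auto
  then have \<kappa>1: "\<kappa> \<le> lam * (8 * T\<^sup>2 / \<epsilon>)" by (simp add: mult_ac)
  also have "\<dots> \<le> C * d0\<^sup>2 / \<epsilon> * (8 * T\<^sup>2 / \<epsilon>)"
    using lam2 pos by (intro mult_right_mono) auto
  finally have \<kappa>a: "\<kappa> \<le> 8 * C * a" by (simp add: a_def power2_eq_square field_simps)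
  have "real k = (\<Sum>i<k. 1)" by simp
  also have "\<dots> \<le> (\<Sum>i<k. \<theta> ^ i)" using \<theta> by (intro sum_mono) simp
  finally have "\<epsilon> * lam * real k \<le> \<epsilon> * lam * (\<Sum>i<k. \<theta> ^ i)" using pos by (intro mult_left_mono) auto
  then have "\<epsilon> * lam * real k \<le> d0\<^sup>2" using k by (simp add: \<theta>_def)
  then have k1: "real k \<le> d0\<^sup>2 / \<epsilon> * (1 / lam)" using pos by (simp add: field_simps)
  have "real k * (1 + \<kappa>) \<le> real k * (1 + lam * (8 * T\<^sup>2 / \<epsilon>))"
    using \<kappa>1 by (intro mult_left_mono) auto
  also have "\<dots> \<le> d0\<^sup>2 / \<epsilon> * (1 / lam) * (1 + lam * (8 * T\<^sup>2 / \<epsilon>))"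
    using k1 pos by (intro mult_right_mono) (auto intro!: add_nonneg_nonneg)
  also have "\<dots> = d0\<^sup>2 / \<epsilon> * (1 / lam) + 8 * a"
    using pos by (simp add: a_def power2_eq_square field_simps)
  also have "\<dots> \<le> d0\<^sup>2 / \<epsilon> * (C * T\<^sup>2 / \<epsilon>) + 8 * a"
    using inv pos by (intro add_right_mono mult_left_mono) auto
  also have "\<dots> = (C + 8) * a" using pos by (simp add: a_def power2_eq_square field_simps)
  finally have "real k * (1 + \<kappa>) \<le> (C + 8) * a" .
  then have A: "(real k + 1) * (1 + \<kappa>) \<le> (9 * C + 16) * a + 1"
    using \<kappa>a a0 by (simp add: algebra_simps)
  define b where "b = (if \<mu> = 0 then a else (T\<^sup>2 / (\<mu> * \<epsilon>) + 1) * ln (\<mu> * d0\<^sup>2 / \<epsilon> + 1))"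
  have B: "(real k + 1) * (1 + \<kappa>) \<le> (9 * C + 16) * b + 1"
  proof (cases "\<mu> = 0")
    case True
    then show ?thesis using A by (simp add: b_def)
  next
    case False
    then have \<mu>p: "0 < \<mu>" using \<mu> by simp
    define S where "S = T\<^sup>2 / (\<mu> * \<epsilon>)"
    define Z where "Z = \<mu> * d0\<^sup>2 / \<epsilon>"
    define Lg where "Lg = ln (1 + Z)"
    have b: "b = (S + 1) * Lg" using False by (simp add: b_def S_def Lg_def Z_def add.commute)
    have S: "0 < S" using \<mu>p pos by (simp add: S_def)
    have Z: "0 \<le> Z" using \<mu>p pos by (simp add: Z_def)
    have Lg: "0 \<le> Lg" using Z by (simp add: Lg_def)
    have ln_low: "s / (1 + s) \<le> ln (1 + s)" if "0 \<le> s" for s :: real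
      using ln_le_minus_one[of "1 / (1 + s)"] that by (simp add: ln_div field_simps)
    have \<theta>1: "1 < \<theta>" using pos \<mu>p by (simp add: \<theta>_def)
    have "(\<Sum>i<k. \<theta> ^ i) = (\<theta> ^ k - 1) / (lam * \<mu>)"
      using geometric_sum[of \<theta> k] pos \<mu>p by (simp add: \<theta>_def)
    then have "\<epsilon> * lam * ((\<theta> ^ k - 1) / (lam * \<mu>)) \<le> d0\<^sup>2" using k by (simp add: \<theta>_def)
    moreover have "\<epsilon> * lam * ((\<theta> ^ k - 1) / (lam * \<mu>)) = \<epsilon> * (\<theta> ^ k - 1) / \<mu>"
      using pos by simp
    ultimately have "\<epsilon> * (\<theta> ^ k - 1) / \<mu> \<le> d0\<^sup>2" by (simp only:)
    then have "\<theta> ^ k \<le> 1 + Z" using pos \<mu>p by (simp add: Z_def field_simps)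
    then have "ln (\<theta> ^ k) \<le> Lg" unfolding Lg_def using \<theta>1 Z by (subst ln_le_cancel_iff) auto
    then have kl: "real k * ln \<theta> \<le> Lg" using \<theta>1 by (simp add: ln_realpow)
    have "lam * \<mu> / \<theta> \<le> ln \<theta>" using ln_low[of "lam * \<mu>"] pos \<mu> by (simp add: \<theta>_def)
    then have "real k * (lam * \<mu> / \<theta>) \<le> Lg"
      using kl mult_left_mono[of "lam * \<mu> / \<theta>" "ln \<theta>" "real k"] by linarith
    then have k2: "real k \<le> \<theta> / (lam * \<mu>) * Lg" using pos \<mu>p \<theta>1 by (simp add: field_simps)
    have "real k * (1 + \<kappa>) \<le> \<theta> / (lam * \<mu>) * Lg * (1 + \<kappa>)"
      using k2 \<kappa>0 by (intro mult_right_mono) auto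
    also have "\<dots> = (1 + 1 / lam * (1 / \<mu>) + 8 * S) * Lg"
    proof -
      have "\<theta> / (lam * \<mu>) = 1 + 1 / lam * (1 / \<mu>)"
        using pos \<mu>p by (simp add: \<theta>_def field_simps)
      moreover have "\<theta> / (lam * \<mu>) * \<kappa> = 8 * S"
        using pos \<mu>p \<theta>1 by (simp add: \<kappa>_def S_def field_simps)
      moreover have "\<theta> / (lam * \<mu>) * Lg * (1 + \<kappa>)
          = (\<theta> / (lam * \<mu>) + \<theta> / (lam * \<mu>) * \<kappa>) * Lg"
        by (simp add: distrib_left distrib_right)
      ultimately show ?thesis by (simp only:)
    qed
    also have "\<dots> \<le> (1 + C * S + 8 * S) * Lg"
    proof (intro mult_right_mono add_mono Lg order_refl)
      show "1 / lam * (1 / \<mu>) \<le> C * S"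
        using mult_right_mono[OF inv, of "1 / \<mu>"] \<mu>p by (simp add: S_def mult.commute)
    qed (use S in simp)
    finally have 1: "real k * (1 + \<kappa>) \<le> (1 + C * S + 8 * S) * Lg" .
    have "\<kappa> \<le> 8 * (1 + C) * (S * Lg)"
    proof -
      \<comment> \<open>monotonicity of \<open>s \<mapsto> s / (1 + \<mu> s)\<close>, applied to \<open>lam \<le> C d0\<^sup>2 / \<epsilon>\<close>\<close>
      have "lam / \<theta> \<le> (1 + C) * (Z / (1 + Z)) / \<mu>"
      proof -
        have l2: "lam * \<mu> \<le> C * Z"
          using mult_right_mono[OF lam2, of \<mu>] \<mu>p by (simp add: Z_def mult_ac)
        have "lam * \<mu> * (1 + Z) \<le> (1 + C) * Z * (1 + lam * \<mu>)"
        proof -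
          have "0 \<le> lam * \<mu> * Z" "0 \<le> C * (Z * (lam * \<mu>))" using pos \<mu> Z by auto
          then show ?thesis using l2 Z by (simp add: algebra_simps)
        qed
        then have "lam * \<mu> * (1 + Z) / (\<theta> * \<mu> * (1 + Z)) \<le> (1 + C) * Z * \<theta> / (\<theta> * \<mu> * (1 + Z))"
          using \<mu>p Z \<theta>1 by (intro divide_right_mono) (auto simp: \<theta>_def)
        moreover have "1 + Z \<noteq> 0" "\<theta> \<noteq> 0" "\<mu> \<noteq> 0" using Z \<theta>1 \<mu>p by auto
        ultimately show ?thesis by (simp add: mult.commute)
      qed
      also have "\<dots> \<le> (1 + C) * Lg / \<mu>"
        using ln_low[OF Z] pos \<mu>p unfolding Lg_def by (intro divide_right_mono mult_left_mono) auto
      finally have "lam / \<theta> * (8 * T\<^sup>2 / \<epsilon>) \<le> (1 + C) * Lg / \<mu> * (8 * T\<^sup>2 / \<epsilon>)"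
        using pos by (intro mult_right_mono) auto
      then show ?thesis using pos by (simp add: \<kappa>_def S_def field_simps)
    qed
    then have "(real k + 1) * (1 + \<kappa>) \<le> (1 + C * S + 8 * S) * Lg + 8 * (1 + C) * (S * Lg) + 1"
      using 1 by (simp add: algebra_simps)
    also have "\<dots> = (9 * C + 16) * (S * Lg) + Lg + 1" by (simp add: algebra_simps)
    also have "\<dots> \<le> (9 * C + 16) * b + 1"
    proof -
      have "1 * Lg \<le> (9 * C + 16) * Lg" using pos Lg by (intro mult_right_mono) auto
      then show ?thesis by (simp add: b algebra_simps)
    qed
    finally show ?thesis .
  qed
  have "(real k + 1) * (1 + \<kappa>) \<le> (9 * C + 16) * min a b + 1"
    using A B by (simp add: min_def)
  also have "\<dots> \<le> (9 * C + 16) * (min a b + 1)" using pos by (simp add: algebra_simps)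
  also have "min a b + 1 = complexity \<mu> \<epsilon> T d0"
    by (simp add: complexity_def a_def b_def Let_def)
  finally show ?thesis by (simp add: \<kappa>_def \<theta>_def)
qed

theorem corollary3p2:
  fixes C :: real
  assumes "C > 0"
  shows "\<exists>C'>0. \<forall>n\<ge>1. \<forall>(x0::fseq) (\<epsilon>::real) f f' h Lf Mf \<mu> Mbar Lbar x0s lam d0 T x xc y \<Gamma> m t.
    instance_A1_A3 (Rn n) f f' h Lf Mf \<mu> \<longrightarrow>
    x0 \<in> edom (Rn n) h \<longrightarrow>
    \<epsilon> > 0 \<longrightarrow>
    is_argmin_on (opt_set (Rn n) f h) (\<lambda>z. norm (x0 - z)) x0s \<longrightarrow>
    d0 = norm (x0 - x0s) \<longrightarrow>
    is_argmin_on (Omega (Rn n) f' h) (\<lambda>(M, L). M\<^sup>2 + \<epsilon> * L) (Mbar, Lbar) \<longrightarrow>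
    T = T_eps \<epsilon> Mbar Lbar \<longrightarrow>
    T > 0 \<longrightarrow>
    lam > 0 \<longrightarrow>
    \<epsilon> / (C * T\<^sup>2) \<le> lam \<longrightarrow>
    lam \<le> C * d0\<^sup>2 / \<epsilon> \<longrightarrow>
    tau_free_GPB (Rn n) f f' h \<mu> T x0 lam \<epsilon> x xc y \<Gamma> m t \<longrightarrow>
    (\<exists>j. eps_solution (Rn n) f h \<epsilon> (y j)) \<and>
    real (LEAST j. eps_solution (Rn n) f h \<epsilon> (y j))
      \<le> C' * (1 + log_plus (4 * tbar lam d0 Mbar Lbar / \<epsilon>)) * complexity \<mu> \<epsilon> T d0"
  \<comment> \<open>\<open>9 * C + 16\<close> comes from \<open>cycles_le_complexity\<close>; the \<open>6\<close> consists of \<open>5\<close> for the length of a cycle,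
    \<open>2 + (3 + log) (1 + \<kappa>) \<le> 5 (1 + log) (1 + \<kappa>)\<close>, and \<open>1\<close> for the step that reaches the solution.\<close>
proof (intro exI[of _ "6 * (9 * C + 16)"] conjI allI impI)
  show "0 < 6 * (9 * C + 16)" using assms by simp
next
  fix n and x0 :: fseq and \<epsilon> :: real and f f' h Lf Mf \<mu> Mbar Lbar x0s lam d0 T x xc y \<Gamma> m t
  assume inst: "instance_A1_A3 (Rn n) f f' h Lf Mf \<mu>"
    and x0: "x0 \<in> edom (Rn n) h"
    and \<epsilon>: "\<epsilon> > 0"
    and x0s: "is_argmin_on (opt_set (Rn n) f h) (\<lambda>z. norm (x0 - z)) x0s"
    and d0: "d0 = norm (x0 - x0s)"
    and bar: "is_argmin_on (Omega (Rn n) f' h) (\<lambda>(M, L). M\<^sup>2 + \<epsilon> * L) (Mbar, Lbar)"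
    and T: "T = T_eps \<epsilon> Mbar Lbar" and Tpos: "T > 0"
    and lam: "lam > 0" and lam1: "\<epsilon> / (C * T\<^sup>2) \<le> lam" and lam2: "lam \<le> C * d0\<^sup>2 / \<epsilon>"
    and run: "tau_free_GPB (Rn n) f f' h \<mu> T x0 lam \<epsilon> x xc y \<Gamma> m t"
  let ?sol = "\<lambda>j. eps_solution (Rn n) f h \<epsilon> (y j)"
  let ?lp = "log_plus (4 * tbar lam d0 Mbar Lbar / \<epsilon>)"
  let ?cx = "complexity \<mu> \<epsilon> T d0"
  have \<mu>: "0 \<le> \<mu>" using inst by (simp add: instance_A1_A3_def)
  have bar_adm: "0 \<le> Mbar" "0 \<le> Lbar" "A3 (Rn n) f' h Mbar Lbar"
    using bar by (auto simp: is_arg_min_def Omega_def)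
  have T2: "T\<^sup>2 = Mbar\<^sup>2 + \<epsilon> * Lbar" using bar_adm \<epsilon> by (simp add: T T_eps_def)
  \<comment> \<open>the smallest admissible \<open>\<tau>\<close>, for which \<open>\<tau> / (1 - \<tau>) = \<kappa>\<close>\<close>
  define \<kappa> where "\<kappa> = 8 * lam * T\<^sup>2 / ((1 + lam * \<mu>) * \<epsilon>)"
  define \<tau> where "\<tau> = \<kappa> / (1 + \<kappa>)"
  have \<kappa>: "0 < \<kappa>" using lam \<epsilon> \<mu> Tpos by (simp add: \<kappa>_def add_pos_nonneg)
  have 1: "1 / (1 - \<tau>) = 1 + \<kappa>" using \<kappa> by (simp add: \<tau>_def field_simps)
  have \<tau>: "0 < \<tau>" "\<tau> < 1" "\<tau> / (1 - \<tau>) = \<kappa>" using \<kappa> by (simp_all add: \<tau>_def field_simps)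
  have "GPB (Rn n) f f' h \<mu> x0 lam \<epsilon> \<tau> x xc y \<Gamma> m t"
    using run \<tau> by (simp add: tau_free_GPB_def admissible_tau_def \<kappa>_def)
  moreover have "is_argmin_on (Rn n) (phi f h) x0s"
    using x0s by (simp add: is_arg_min_def opt_set_def)
  ultimately interpret GPB_run "Rn n" f h f' Mbar Lbar \<mu> lam \<epsilon> \<tau> x0 x0s x xc y \<Gamma> m t
    using inst x0 \<epsilon> bar_adm lam \<tau> by unfold_locales (auto simp: instance_A1_A3_def \<kappa>_def T2)
  have lp0: "0 \<le> ?lp" by (simp add: log_plus_def)
  have cx: "1 \<le> (9 * C + 16) * ?cx"
    using cycles_le_complexity[OF assms \<epsilon> lam Tpos \<mu> lam1 lam2, of 0] \<kappa> by (simp add: \<kappa>_def)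
  have bound: "real N \<le> 5 * (9 * C + 16) * (1 + ?lp) * ?cx" if none: "\<And>j. j \<le> N \<Longrightarrow> \<not> ?sol j" for N
  proof -
    let ?l = "2 + log_plus (4 * (16 * tbar lam d0 Mbar Lbar) / \<epsilon>) / (1 - \<tau>)"
    obtain k where k: "real N \<le> (real k + 1) * ?l"
      "\<epsilon> * lam * (\<Sum>i<k. (1 + lam * \<mu>) ^ i) \<le> d0\<^sup>2"
      using iteration_count[OF none, of N] d0 by auto
    have "log_plus (4 * (16 * tbar lam d0 Mbar Lbar) / \<epsilon>) \<le> 3 + ?lp"
      using log_plus_16_mult[of "4 * tbar lam d0 Mbar Lbar / \<epsilon>"] \<epsilon> bar_adm
      by (simp add: tbar_def mult.left_commute)
    then have "log_plus (4 * (16 * tbar lam d0 Mbar Lbar) / \<epsilon>) * (1 + \<kappa>) \<le> (3 + ?lp) * (1 + \<kappa>)"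
      using \<kappa> by (intro mult_right_mono) auto
    moreover have "?l = 2 + log_plus (4 * (16 * tbar lam d0 Mbar Lbar) / \<epsilon>) * (1 + \<kappa>)"
      using 1 by (simp add: divide_inverse)
    moreover have "2 + (3 + ?lp) * (1 + \<kappa>) \<le> 5 * (1 + ?lp) * (1 + \<kappa>)"
    proof -
      have "0 \<le> ?lp * \<kappa>" using lp0 \<kappa> by simp
      then show ?thesis using lp0 \<kappa> by (simp add: algebra_simps)
    qed
    ultimately have "?l \<le> 5 * (1 + ?lp) * (1 + \<kappa>)" by linarith
    then have "(real k + 1) * ?l \<le> (real k + 1) * (5 * (1 + ?lp) * (1 + \<kappa>))"
      by (intro mult_left_mono) auto
    from order_trans[OF k(1) this] have "real N \<le> 5 * (1 + ?lp) * ((real k + 1) * (1 + \<kappa>))"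
      by (simp only: mult_ac)
    also have "\<dots> \<le> 5 * (1 + ?lp) * ((9 * C + 16) * ?cx)"
      using cycles_le_complexity[OF assms \<epsilon> lam Tpos \<mu> lam1 lam2 k(2)] lp0
      by (intro mult_left_mono) (auto simp: \<kappa>_def)
    finally show ?thesis by (simp only: mult_ac)
  qed
  show ex: "\<exists>j. ?sol j"
  proof (rule ccontr)
    assume "\<not> ?thesis"
    then have "real N \<le> 5 * (9 * C + 16) * (1 + ?lp) * ?cx" for N using bound by blast
    then show False using reals_Archimedean2 by (metis not_le)
  qed
  show "real (LEAST j. ?sol j) \<le> 6 * (9 * C + 16) * (1 + ?lp) * ?cx"
  proof -
    have one: "1 \<le> (9 * C + 16) * ?cx * (1 + ?lp)"
      using mult_mono[OF cx, of 1 "1 + ?lp"] cx lp0 by simp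
    show ?thesis
    proof (cases "LEAST j. ?sol j")
      case 0
      then show ?thesis using one by (simp add: algebra_simps)
    next
      case (Suc N)
      then have "\<not> ?sol j" if "j \<le> N" for j using that not_less_Least[of j ?sol] by auto
      then have "real N \<le> 5 * (9 * C + 16) * (1 + ?lp) * ?cx" by (rule bound)
      then show ?thesis using one Suc by (simp add: algebra_simps)
    qed
  qed
qed

end
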